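(* For any prime $p$, there is no $p$-valent regular Cayley map on a dicyclic group; that is, for every prime $p$ and every positive integer $n$ there is no regular Cayley map $CM(\mathrm{Dic}_n,X,q)$ with $|X|=p$.
   Context: For a positive integer $n$, $\mathrm{Dic}_n=\langle a,b\mid a^{2n}=1,\ b^2=a^n,\ b^{-1}ab=a^{-1}\rangle$ is the dicyclic group of order $4n$. All graphs are finite, undirected, connected, without loops or multiple edges. An arc of a graph is an ordered pair of adjacent vertices. A map with underlying graph $\Gamma$ and arc set $D$ is a triple $\mathcal{M}=(D;R,L)$, where $R$ (the rotation) is a permutation of $D$ whose orbits are exactly the sets of arcs based at (i.e. with first coordinate) the same vertex, and $L$ is the involution of $D$ reversing each arc. A map automorphism is a graph automorphism $\phi$ of the underlying graph with $\phi R(x,y)=R\phi(x,y)$ for every arc $(x,y)\in D$. A map is regular if its automorphism group acts regularly on its arc set. Let $G$ be a finite group and $X=X^{-1}$ a subset of $G$ not containing the identity with $\langle X\rangle=G$. The Cayley graph $\mathrm{Cay}(G,X)$ has vertex set $G$, with $g,h$ adjacent iff $g^{-1}h\in X$. For a cyclic permutation $q$ of $X$ (a single cycle containing all of $X$), the Cayley map $CM(G,X,q)$ is the map with underlying graph $\mathrm{Cay}(G,X)$, rotation $R(g,gx)=(g,gq(x))$ and $L(g,gx)=(gx,g)$ for $g\in G$, $x\in X$. It is $k$-valent if $|X|=k$.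
   Formalization: The pair p = 2, n = 1 is excluded: Dic_1 is cyclic of order 4 generated by b, and with X = {b, b^{-1}} the 2-valent Cayley map (a 4-cycle on the sphere) is regular, so the claim fails there. *)

theory Defs
  imports
    "HOL-Computational_Algebra.Primes"
    "HOL-Algebra.Generated_Groups"
    "HOL-Combinatorics.Orbits"
    "Graph_Theory.Graph_Theory"
begin

section \<open>Groups given by generators and relations\<close>

text \<open>
  A letter \<open>(x, True)\<close> stands for the generator \<open>x\<close> and \<open>(x, False)\<close> for its inverse.  A relation
  \<open>u = v\<close> between words is the pair \<open>(u, v)\<close>.
\<close>

type_synonym 'g word = "('g \<times> bool) list"

inductive word_eq :: "'g word rel \<Rightarrow> 'g word \<Rightarrow> 'g word \<Rightarrow> bool" for S where
  relation: "(u, v) \<in> S \<Longrightarrow> word_eq S u v"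
| cancel: "word_eq S [(x, s), (x, \<not> s)] []"
| subword: "word_eq S u v \<Longrightarrow> word_eq S (p @ u @ q) (p @ v @ q)"
| refl: "word_eq S u u"
| sym: "word_eq S u v \<Longrightarrow> word_eq S v u"
| trans: "word_eq S u v \<Longrightarrow> word_eq S v w \<Longrightarrow> word_eq S u w"

definition word_class :: "'g word rel \<Rightarrow> 'g word \<Rightarrow> 'g word set" where
  "word_class S u = {v. word_eq S u v}"

definition presented_group :: "'g word rel \<Rightarrow> 'g word set monoid" where
  "presented_group S =
     \<lparr>carrier = range (word_class S),
      mult = (\<lambda>A B. \<Union>u\<in>A. \<Union>v\<in>B. word_class S (u @ v)),
      one = word_class S []\<rparr>"

datatype dic_gen = DA | DB

definition dic_relations :: "nat \<Rightarrow> dic_gen word rel" where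
  "dic_relations n =
     {(replicate (2 * n) (DA, True), []),
      ([(DB, True), (DB, True)], replicate n (DA, True)),
      ([(DB, False), (DA, True), (DB, True)], [(DA, False)])}"

definition Dic :: "nat \<Rightarrow> dic_gen word set monoid" where
  "Dic n = presented_group (dic_relations n)"

section \<open>Maps\<close>

text \<open>The arc set of a map is the set \<open>parcs\<close> of its underlying graph.\<close>

record 'v graph_map =
  graph :: "'v pair_pre_digraph"
  rot :: "'v \<times> 'v \<Rightarrow> 'v \<times> 'v"
  arev :: "'v \<times> 'v \<Rightarrow> 'v \<times> 'v"

definition is_map :: "'v graph_map \<Rightarrow> bool" where
  "is_map M \<longleftrightarrow>
     pair_graph (graph M) \<and> connected (with_proj (graph M)) \<and>
     rot M permutes parcs (graph M) \<and>
     (\<forall>d \<in> parcs (graph M). orbit (rot M) d = {e \<in> parcs (graph M). fst e = fst d}) \<and>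
     arev M permutes parcs (graph M) \<and>
     (\<forall>(x, y) \<in> parcs (graph M). arev M (x, y) = (y, x))"

definition graph_automorphisms :: "'v pair_pre_digraph \<Rightarrow> ('v \<Rightarrow> 'v) set" where
  "graph_automorphisms \<Gamma> =
     {\<phi>. \<phi> permutes pverts \<Gamma> \<and>
         (\<forall>x \<in> pverts \<Gamma>. \<forall>y \<in> pverts \<Gamma>. (\<phi> x, \<phi> y) \<in> parcs \<Gamma> \<longleftrightarrow> (x, y) \<in> parcs \<Gamma>)}"

definition map_automorphisms :: "'v graph_map \<Rightarrow> ('v \<Rightarrow> 'v) set" where
  "map_automorphisms M =
     {\<phi> \<in> graph_automorphisms (graph M).
        \<forall>(x, y) \<in> parcs (graph M). map_prod \<phi> \<phi> (rot M (x, y)) = rot M (\<phi> x, \<phi> y)}"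

definition regular_map :: "'v graph_map \<Rightarrow> bool" where
  "regular_map M \<longleftrightarrow>
     is_map M \<and>
     (\<forall>d \<in> parcs (graph M). \<forall>e \<in> parcs (graph M).
        \<exists>!\<phi>. \<phi> \<in> map_automorphisms M \<and> map_prod \<phi> \<phi> d = e)"

section \<open>Cayley maps\<close>

definition Cay :: "('a, 'b) monoid_scheme \<Rightarrow> 'a set \<Rightarrow> 'a pair_pre_digraph" where
  "Cay G X =
     \<lparr>pverts = carrier G,
      parcs = {(g, h). g \<in> carrier G \<and> h \<in> carrier G \<and> inv\<^bsub>G\<^esub> g \<otimes>\<^bsub>G\<^esub> h \<in> X}\<rparr>"

definition CM :: "('a, 'b) monoid_scheme \<Rightarrow> 'a set \<Rightarrow> ('a \<Rightarrow> 'a) \<Rightarrow> 'a graph_map" where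
  "CM G X q =
     \<lparr>graph = Cay G X,
      rot = (\<lambda>(g, h). if (g, h) \<in> parcs (Cay G X)
                      then (g, g \<otimes>\<^bsub>G\<^esub> q (inv\<^bsub>G\<^esub> g \<otimes>\<^bsub>G\<^esub> h)) else (g, h)),
      arev = (\<lambda>(g, h). if (g, h) \<in> parcs (Cay G X) then (h, g) else (g, h))\<rparr>"

definition cayley_map_data :: "('a, 'b) monoid_scheme \<Rightarrow> 'a set \<Rightarrow> ('a \<Rightarrow> 'a) \<Rightarrow> bool" where
  "cayley_map_data G X q \<longleftrightarrow>
     group G \<and> finite (carrier G) \<and>
     X \<subseteq> carrier G \<and> (\<lambda>x. inv\<^bsub>G\<^esub> x) ` X = X \<and> \<one>\<^bsub>G\<^esub> \<notin> X \<and> generate G X = carrier G \<and>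
     q permutes X \<and> cyclic_on q X"

section \<open>The presented group is a group\<close>

lemma word_eq_append: "word_eq S u u' \<Longrightarrow> word_eq S v v' \<Longrightarrow> word_eq S (u @ v) (u' @ v')"
  using word_eq.subword[of S u u' "[]" v] word_eq.subword[of S v v' u' "[]"]
  by (auto intro: word_eq.trans)

lemma word_class_eq_iff: "word_class S u = word_class S v \<longleftrightarrow> word_eq S u v"
  unfolding word_class_def set_eq_iff by (auto intro: word_eq.refl word_eq.sym word_eq.trans)

lemma carrier_presented_group: "carrier (presented_group S) = range (word_class S)"
  and one_presented_group: "\<one>\<^bsub>presented_group S\<^esub> = word_class S []"
  by (simp_all add: presented_group_def)

lemma mult_presented_group:
  "word_class S u \<otimes>\<^bsub>presented_group S\<^esub> word_class S v = word_class S (u @ v)"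
proof -
  have *: "word_class S (u' @ v') = word_class S (u @ v)"
    if "u' \<in> word_class S u" "v' \<in> word_class S v" for u' v'
    using that word_eq_append[of S u u' v v'] word_class_eq_iff[of S "u @ v" "u' @ v'"]
    by (simp add: word_class_def)
  have "u \<in> word_class S u" "v \<in> word_class S v"
    by (simp_all add: word_class_def word_eq.refl)
  then have "(\<Union>u'\<in>word_class S u. \<Union>v'\<in>word_class S v. word_class S (u' @ v')) = word_class S (u @ v)"
    using * by blast
  then show ?thesis
    by (simp add: presented_group_def)
qed

lemma word_eq_inverse: "word_eq S (rev (map (\<lambda>(x, s). (x, \<not> s)) u) @ u) []"
proof (induction u)
  case (Cons a u)
  obtain x s where a: "a = (x, s)" by force
  have "word_eq S [(x, \<not> s), (x, s)] []" using word_eq.cancel[of S x "\<not> s"] by simp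
  from word_eq.subword[OF this, of "rev (map (\<lambda>(x, s). (x, \<not> s)) u)" u] Cons a
  show ?case by (auto intro: word_eq.trans)
qed (auto intro: word_eq.refl)

lemma group_presented_group: "group (presented_group S)"
proof (rule groupI)
  fix A assume "A \<in> carrier (presented_group S)"
  then obtain u where "A = word_class S u" by (auto simp: carrier_presented_group)
  then have "word_class S (rev (map (\<lambda>(x, s). (x, \<not> s)) u)) \<otimes>\<^bsub>presented_group S\<^esub> A = \<one>\<^bsub>presented_group S\<^esub>"
    by (simp add: mult_presented_group one_presented_group word_class_eq_iff word_eq_inverse)
  then show "\<exists>B\<in>carrier (presented_group S). B \<otimes>\<^bsub>presented_group S\<^esub> A = \<one>\<^bsub>presented_group S\<^esub>"
    by (auto simp: carrier_presented_group)
qed (auto simp: carrier_presented_group one_presented_group mult_presented_group)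

section \<open>\<open>Dic n\<close> has order \<open>4 * n\<close>\<close>

lemma group_Dic: "group (Dic n)"
  by (simp add: Dic_def group_presented_group)

text \<open>
  The left translations of \<open>{a^i b^e}\<close>, with \<open>(i, e)\<close> encoding \<open>a^i b^e\<close>: they separate the normal
  forms.
\<close>

fun dic_act1 :: "nat \<Rightarrow> dic_gen \<times> bool \<Rightarrow> int \<times> bool \<Rightarrow> int \<times> bool" where
  "dic_act1 n (DA, True) (i, e) = ((i + 1) mod (2 * int n), e)"
| "dic_act1 n (DA, False) (i, e) = ((i - 1) mod (2 * int n), e)"
| "dic_act1 n (DB, True) (i, e) = ((if e then int n - i else - i) mod (2 * int n), \<not> e)"
| "dic_act1 n (DB, False) (i, e) = ((if e then - i else int n - i) mod (2 * int n), \<not> e)"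

definition dic_act :: "nat \<Rightarrow> dic_gen word \<Rightarrow> int \<times> bool \<Rightarrow> int \<times> bool" where
  "dic_act n w = foldr (dic_act1 n) w"

lemma dic_act1_closed: "n > 0 \<Longrightarrow> dic_act1 n l c \<in> {0..<2 * int n} \<times> UNIV"
  by (cases "(n, l, c)" rule: dic_act1.cases) auto

lemma dic_act_closed:
  "n > 0 \<Longrightarrow> c \<in> {0..<2 * int n} \<times> UNIV \<Longrightarrow> dic_act n w c \<in> {0..<2 * int n} \<times> UNIV"
  by (cases w) (auto simp: dic_act_def simp del: atLeastLessThan_iff intro: dic_act1_closed)

lemma dic_act_append: "dic_act n (u @ v) c = dic_act n u (dic_act n v c)"
  by (simp add: dic_act_def)

lemma dic_act_replicate:
  assumes "n > 0" "i \<in> {0..<2 * int n}"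
  shows "dic_act n (replicate k (DA, True)) (i, e) = ((int k + i) mod (2 * int n), e)"
  using assms(2) by (induction k) (auto simp: dic_act_def mod_simps algebra_simps)

lemma dic_act_cong:
  assumes "word_eq (dic_relations n) u v" "n > 0"
  shows "c \<in> {0..<2 * int n} \<times> UNIV \<Longrightarrow> dic_act n u c = dic_act n v c"
  using assms(1)
proof (induction arbitrary: c)
  case (relation u v)
  obtain i e where c: "c = (i, e)" by force
  with relation.prems have i: "i \<in> {0..<2 * int n}" by auto
  have [simp]: "(n + int n + i) mod (2 * int n) = i" using i mod_add_self1[of "2 * int n" i] by simp
  have [simp]: "(i - int n) mod (2 * int n) = (i + int n) mod (2 * int n)"
    using mod_add_self2[of "i - int n" "2 * int n"] by (simp add: algebra_simps)
  have [simp]: "(i - int n) mod (int n * 2) = (i + int n) mod (int n * 2)"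
    using mod_add_self2[of "i - int n" "2 * int n"] by (simp add: algebra_simps)
  show ?case
    using relation i assms(2)
    by (auto simp: dic_relations_def c dic_act_replicate dic_act_def[of _ "_ # _"] mod_simps algebra_simps
        dic_act_def[of _ "[]"])
next
  case (cancel x s)
  show ?case
    using cancel assms(2) by (cases x; cases s; cases c) (auto simp: dic_act_def mod_simps algebra_simps)
next
  case (subword u v p q)
  then show ?case using dic_act_closed[OF assms(2)] by (simp add: dic_act_append)
next
  case refl
  show ?case by (rule HOL.refl)
next
  case (sym u v)
  show ?case using sym.IH[OF sym.prems] by (rule HOL.sym)
next
  case (trans u v w)
  show ?case using trans.IH(1)[OF trans.prems] trans.IH(2)[OF trans.prems] by (rule HOL.trans)
qed

lemma Dic_mult: "word_class (dic_relations n) u \<otimes>\<^bsub>Dic n\<^esub> word_class (dic_relations n) v = word_class (dic_relations n) (u @ v)"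
  by (simp add: Dic_def mult_presented_group)

lemma Dic_one: "\<one>\<^bsub>Dic n\<^esub> = word_class (dic_relations n) []"
  by (simp add: Dic_def one_presented_group)

lemma carrier_Dic: "carrier (Dic n) = range (word_class (dic_relations n))"
  by (simp add: Dic_def carrier_presented_group)

lemma word_eq_DA_replicate:
  "word_eq (dic_relations n) (replicate k (DA, True)) (replicate (k mod (2 * n)) (DA, True))"
proof -
  have *: "word_eq (dic_relations n) (replicate (2 * n * j) (DA, True)) []" for j
  proof (induction j)
    case (Suc j)
    have "word_eq (dic_relations n) (replicate (2 * n) (DA, True)) []"
      by (rule word_eq.relation) (simp add: dic_relations_def)
    from word_eq_append[OF this Suc] show ?case
      by (simp flip: replicate_add)
  qed (simp add: word_eq.refl)
  have "replicate k (DA, True) =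
    replicate (2 * n * (k div (2 * n))) (DA, True) @ replicate (k mod (2 * n)) (DA, True)"
    by (simp flip: replicate_add)
  then show ?thesis
    using word_eq.subword[OF *[of "k div (2 * n)"], of "[]" "replicate (k mod (2 * n)) (DA, True)"] by simp
qed

lemma word_eq_winv: "word_eq S (u @ v) [] \<Longrightarrow> word_eq S (rev (map (\<lambda>(x, s). (x, \<not> s)) u)) v"
proof -
  let ?i = "rev (map (\<lambda>(x, s). (x, \<not> s)) u)"
  assume "word_eq S (u @ v) []"
  then have "word_eq S (?i @ u @ v) ?i"
    using word_eq.subword[of S "u @ v" "[]" ?i "[]"] by simp
  moreover have "word_eq S (?i @ u @ v) v"
    using word_eq.subword[OF word_eq_inverse[of S u], of "[]" v] by simp
  ultimately show ?thesis by (rule word_eq.trans[OF word_eq.sym])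
qed

lemma word_eq_DA_inv:
  assumes "n > 0"
  shows "word_eq (dic_relations n) [(DA, False)] (replicate (2 * n - 1) (DA, True))"
proof -
  have "[(DA, True)] @ replicate (2 * n - 1) (DA, True) = replicate (2 * n) (DA, True)"
    using assms by (cases n) auto
  moreover have "word_eq (dic_relations n) (replicate (2 * n) (DA, True)) []"
    by (rule word_eq.relation) (simp add: dic_relations_def)
  ultimately have "word_eq (dic_relations n) ([(DA, True)] @ replicate (2 * n - 1) (DA, True)) []"
    by simp
  from word_eq_winv[OF this] show ?thesis by simp
qed

lemma word_eq_DA_DB:
  assumes "n > 0"
  shows "word_eq (dic_relations n) ((DB, True) # replicate k (DA, True))
           (replicate (k * (2 * n - 1)) (DA, True) @ [(DB, True)])"
proof (induction k)
  case (Suc k)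
  let ?e = "word_eq (dic_relations n)" and ?a = "(DA, True)" and ?b = "(DB, True)"
  have 1: "?e ([(DB, False), ?a, ?b]) [(DA, False)]"
    by (rule word_eq.relation) (simp add: dic_relations_def)
  have "?e [?b, (DB, False), ?a, ?b] [?a, ?b]"
    using word_eq.subword[OF word_eq.cancel[of "dic_relations n" DB True], of "[]" "[?a, ?b]"] by simp
  moreover have "?e [?b, (DB, False), ?a, ?b] [?b, (DA, False)]"
    using word_eq.subword[OF 1, of "[?b]" "[]"] by simp
  ultimately have 3: "?e [?a, ?b] [?b, (DA, False)]"
    by (rule word_eq.trans[OF word_eq.sym])
  have "?e [?a, ?b, ?a] [?b, (DA, False), ?a]"
    using word_eq.subword[OF 3, of "[]" "[?a]"] by simp
  moreover have "?e [?b, (DA, False), ?a] [?b]"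
    using word_eq.subword[OF word_eq.cancel[of "dic_relations n" DA False], of "[?b]" "[]"] by simp
  ultimately have 4: "?e ([?a, ?b, ?a]) [?b]"
    by (rule word_eq.trans)
  have "?e [(DA, False), ?a, ?b, ?a] [?b, ?a]"
    using word_eq.subword[OF word_eq.cancel[of "dic_relations n" DA False], of "[]" "[?b, ?a]"] by simp
  moreover have "?e [(DA, False), ?a, ?b, ?a] [(DA, False), ?b]"
    using word_eq.subword[OF 4, of "[(DA, False)]" "[]"] by simp
  ultimately have 5: "?e [?b, ?a] [(DA, False), ?b]"
    by (rule word_eq.trans[OF word_eq.sym])
  have "?e [(DA, False), ?b] (replicate (2 * n - 1) ?a @ [?b])"
    using word_eq.subword[OF word_eq_DA_inv[OF assms], of "[]" "[?b]"] by simp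
  with 5 have 6: "?e [?b, ?a] (replicate (2 * n - 1) ?a @ [?b])"
    by (rule word_eq.trans)
  have "?e (?b # ?a # replicate k ?a) (replicate (2 * n - 1) ?a @ ?b # replicate k ?a)"
    using word_eq.subword[OF 6, of "[]" "replicate k ?a"] by simp
  moreover have "?e (replicate (2 * n - 1) ?a @ ?b # replicate k ?a)
      (replicate (2 * n - 1) ?a @ replicate (k * (2 * n - 1)) ?a @ [?b])"
    using word_eq.subword[OF Suc, of "replicate (2 * n - 1) ?a" "[]"] by simp
  ultimately have "?e (?b # ?a # replicate k ?a)
      (replicate (2 * n - 1) ?a @ replicate (k * (2 * n - 1)) ?a @ [?b])"
    by (rule word_eq.trans)
  then show ?case
    by (simp add: replicate_add)
qed (simp add: word_eq.refl)

lemma word_eq_DB_inv: "word_eq (dic_relations n) [(DB, False)] ((DB, True) # replicate n (DA, True))"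
proof -
  have "word_eq (dic_relations n) ([(DB, True), (DB, True)] @ replicate n (DA, True)) (replicate n (DA, True) @ replicate n (DA, True))"
    by (intro word_eq_append word_eq.refl word_eq.relation) (simp add: dic_relations_def)
  also have "replicate n (DA, True) @ replicate n (DA, True) = replicate (2 * n) (DA, True)"
    by (simp add: mult_2 replicate_add)
  finally have 1: "word_eq (dic_relations n) ([(DB, True), (DB, True)] @ replicate n (DA, True))
    (replicate (2 * n) (DA, True))" .
  have "word_eq (dic_relations n) (replicate (2 * n) (DA, True)) []"
    by (rule word_eq.relation) (simp add: dic_relations_def)
  from word_eq.trans[OF 1 this]
  have "word_eq (dic_relations n) ([(DB, True)] @ ((DB, True) # replicate n (DA, True))) []" by simp
  from word_eq_winv[OF this] show ?thesis by simp
qed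

definition dic_nf :: "nat \<Rightarrow> bool \<Rightarrow> dic_gen word" where
  "dic_nf k e = replicate k (DA, True) @ (if e then [(DB, True)] else [])"

lemma word_eq_nf_DB:
  assumes "n > 0"
  shows "\<exists>k' e'. word_eq (dic_relations n) ((DB, True) # dic_nf k e) (dic_nf k' e')"
proof (cases e)
  case False
  then have "word_eq (dic_relations n) ((DB, True) # dic_nf k e) (dic_nf (k * (2 * n - 1)) True)"
    using word_eq_DA_DB[OF assms] by (simp add: dic_nf_def)
  then show ?thesis by blast
next
  case True
  have "word_eq (dic_relations n) [(DB, True), (DB, True)] (replicate n (DA, True))"
    by (intro word_eq.relation) (simp add: dic_relations_def)
  then have "word_eq (dic_relations n) (replicate (k * (2 * n - 1)) (DA, True) @ [(DB, True), (DB, True)])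
      (dic_nf (k * (2 * n - 1) + n) False)"
    using word_eq.subword[of _ _ _ "replicate (k * (2 * n - 1)) (DA, True)" "[]"] by (fastforce simp: dic_nf_def replicate_add)
  moreover have "word_eq (dic_relations n) ((DB, True) # dic_nf k e) (replicate (k * (2 * n - 1)) (DA, True) @ [(DB, True), (DB, True)])"
    using word_eq.subword[OF word_eq_DA_DB[OF assms, of k], of "[]" "[(DB, True)]"] True
    by (simp add: dic_nf_def)
  ultimately show ?thesis by (blast intro: word_eq.trans)
qed

lemma word_eq_nf_DA:
  "word_eq (dic_relations n) (replicate j (DA, True) @ dic_nf k e) (dic_nf (j + k) e)"
  by (simp add: dic_nf_def replicate_add word_eq.refl)

lemma word_eq_nf:
  assumes "n > 0"
  shows "\<exists>k e. word_eq (dic_relations n) u (dic_nf k e)"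
proof (induction u)
  case Nil
  then show ?case by (metis append_Nil dic_nf_def replicate_0 word_eq.refl)
next
  case (Cons l u)
  then obtain k e where ke: "word_eq (dic_relations n) u (dic_nf k e)" by blast
  from word_eq_append[OF word_eq.refl this, of "[l]"]
  have 1: "word_eq (dic_relations n) (l # u) (l # dic_nf k e)" by simp
  have "\<exists>k' e'. word_eq (dic_relations n) (l # dic_nf k e) (dic_nf k' e')"
  proof -
    consider "l = (DA, True)" | "l = (DA, False)" | "l = (DB, True)" | "l = (DB, False)"
      by (cases l; metis (full_types) dic_gen.exhaust)
    then show ?thesis
    proof cases
      case 1 then show ?thesis using word_eq_nf_DA[of n 1 k e] by auto
    next
      case 2
      then show ?thesis
        using word_eq.trans[OF word_eq.subword[OF word_eq_DA_inv[OF assms], of "[]" "dic_nf k e"]]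
          word_eq_nf_DA[of n "2 * n - 1" k e] by auto
    next
      case 3 then show ?thesis using word_eq_nf_DB[OF assms] by simp
    next
      case 4
      have "word_eq (dic_relations n) (l # dic_nf k e) ((DB, True) # replicate n (DA, True) @ dic_nf k e)"
        using word_eq.subword[OF word_eq_DB_inv[of n], of "[]" "dic_nf k e"] 4 by simp
      moreover have "replicate n (DA, True) @ dic_nf k e = dic_nf (n + k) e"
        by (simp add: dic_nf_def replicate_add)
      ultimately show ?thesis using word_eq_nf_DB[OF assms, of "n + k" e] 
        by (metis word_eq.trans)
    qed
  qed
  with 1 show ?case using word_eq.trans by metis
qed

lemma word_eq_nf_mod: "word_eq (dic_relations n) (dic_nf k e) (dic_nf (k mod (2 * n)) e)"
  unfolding dic_nf_def by (intro word_eq_append word_eq_DA_replicate word_eq.refl)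

lemma bij_betw_nf:
  assumes "n > 0"
  shows "bij_betw (\<lambda>(k, e). word_class (dic_relations n) (dic_nf k e)) ({..<2 * n} \<times> UNIV) (carrier (Dic n))"
  unfolding bij_betw_def
proof
  show "inj_on (\<lambda>(k, e). word_class (dic_relations n) (dic_nf k e)) ({..<2 * n} \<times> UNIV)"
  proof (rule inj_onI, clarsimp simp: word_class_eq_iff)
    fix k e k' e'
    assume *: "k < 2 * n" "k' < 2 * n" "word_eq (dic_relations n) (dic_nf k e) (dic_nf k' e')"
    have "dic_act n (dic_nf j f) (0, False) = (int j, f)" if "j < 2 * n" for j f
      using that assms by (auto simp: dic_nf_def dic_act_append dic_act_replicate dic_act_def[of _ "[_]"]
        dic_act_def[of _ "[]"])
    from dic_act_cong[OF *(3) assms, of "(0, False)"] this[OF *(1), of e] this[OF *(2), of e'] assms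
    show "k = k' \<and> e = e'" by auto
  qed
  have "word_class (dic_relations n) u \<in> (\<lambda>(k, e). word_class (dic_relations n) (dic_nf k e)) ` ({..<2 * n} \<times> UNIV)" for u
  proof -
    obtain k e where "word_eq (dic_relations n) u (dic_nf k e)" using word_eq_nf[OF assms] by blast
    then have "word_eq (dic_relations n) u (dic_nf (k mod (2 * n)) e)"
      by (blast intro: word_eq.trans word_eq_nf_mod)
    then show ?thesis using assms
      by (intro image_eqI[of _ _ "(k mod (2 * n), e)"]) (auto simp: word_class_eq_iff)
  qed
  then show "(\<lambda>(k, e). word_class (dic_relations n) (dic_nf k e)) ` ({..<2 * n} \<times> UNIV) = carrier (Dic n)"
    by (auto simp: carrier_Dic)
qed

lemma order_Dic: "n > 0 \<Longrightarrow> order (Dic n) = 4 * n"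
  using bij_betw_same_card[OF bij_betw_nf] by (simp add: Coset.order_def card_cartesian_product)

lemma finite_Dic: "n > 0 \<Longrightarrow> finite (carrier (Dic n))"
  using bij_betw_finite[OF bij_betw_nf] by simp

section \<open>Cayley maps are maps\<close>

lemma permutes_finite_inj:
  assumes "finite D" "inj_on f D" "f ` D \<subseteq> D" "\<And>x. x \<notin> D \<Longrightarrow> f x = x"
  shows "f permutes D"
  using assms endo_inj_surj[OF assms(1,3,2)] by (intro bij_imp_permutes) (auto simp: bij_betw_def)

lemma is_map_CM:
  assumes "cayley_map_data G X q"
  shows "is_map (CM G X q)"
proof -
  from assms have G: "group G" and fin: "finite (carrier G)" and X: "X \<subseteq> carrier G"
    and inv: "(\<lambda>x. inv\<^bsub>G\<^esub> x) ` X = X" and one: "\<one>\<^bsub>G\<^esub> \<notin> X" and gen: "generate G X = carrier G"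
    and q: "q permutes X" and cyc: "cyclic_on q X"
    by (simp_all add: cayley_map_data_def)
  interpret group G by (rule G)
  let ?D = "parcs (Cay G X)"
  let ?R = "rot (CM G X q)"
  have D: "(g, h) \<in> ?D \<longleftrightarrow> (\<exists>x\<in>X. h = g \<otimes>\<^bsub>G\<^esub> x) \<and> g \<in> carrier G" for g h
  proof
    assume "(g, h) \<in> ?D"
    then have *: "g \<in> carrier G" "h \<in> carrier G" "inv\<^bsub>G\<^esub> g \<otimes>\<^bsub>G\<^esub> h \<in> X" by (auto simp: Cay_def)
    then have "h = g \<otimes>\<^bsub>G\<^esub> (inv\<^bsub>G\<^esub> g \<otimes>\<^bsub>G\<^esub> h)" by (simp flip: m_assoc)
    with * show "(\<exists>x\<in>X. h = g \<otimes>\<^bsub>G\<^esub> x) \<and> g \<in> carrier G" by blast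
  next
    assume "(\<exists>x\<in>X. h = g \<otimes>\<^bsub>G\<^esub> x) \<and> g \<in> carrier G"
    then show "(g, h) \<in> ?D" using X by (auto simp: Cay_def subset_iff simp flip: m_assoc)
  qed
  have Dg: "(g, g \<otimes>\<^bsub>G\<^esub> x) \<in> ?D" if "g \<in> carrier G" "x \<in> X" for g x using that D by blast
  have Dsym: "(h, g) \<in> ?D" if "(g, h) \<in> ?D" for g h
  proof -
    from that have *: "g \<in> carrier G" "h \<in> carrier G" "inv\<^bsub>G\<^esub> g \<otimes>\<^bsub>G\<^esub> h \<in> X" by (auto simp: Cay_def)
    then have "inv\<^bsub>G\<^esub> (inv\<^bsub>G\<^esub> g \<otimes>\<^bsub>G\<^esub> h) \<in> X" using inv by blast
    then have "inv\<^bsub>G\<^esub> h \<otimes>\<^bsub>G\<^esub> g \<in> X" using * by (simp add: inv_mult_group)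
    then show ?thesis using * by (simp add: Cay_def)
  qed
  have finD: "finite ?D"
    by (rule finite_subset[of _ "carrier G \<times> carrier G"]) (auto simp: Cay_def fin)
  have pg: "pair_graph (Cay G X)"
  proof
    show "symmetric (with_proj (Cay G X))" using Dsym by (auto simp: symmetric_def sym_def)
  next
    fix e assume "e \<in> ?D" then show "fst e \<noteq> snd e" using one by (auto simp: Cay_def)
  qed (auto simp: finD fin, auto simp: Cay_def fin)
  interpret pg: pair_graph "Cay G X" by (rule pg)
  have reach: "g \<rightarrow>\<^sup>*\<^bsub>with_proj (Cay G X)\<^esub> (g \<otimes>\<^bsub>G\<^esub> h)" if "h \<in> generate G X" "g \<in> carrier G" for g h
    using that
  proof (induction arbitrary: g)
    case one
    then have "g \<in> pverts (Cay G X)" by (simp add: Cay_def)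
    from pg.reachable_refl[OF this] one show ?case by simp
  next
    case (incl h)
    then show ?case using Dg[of g h] by auto
  next
    case (inv h)
    then have "inv\<^bsub>G\<^esub> h \<in> X" using assms by (auto simp: cayley_map_data_def)
    then show ?case using Dg[OF inv(2)] by auto
  next
    case (eng h1 h2)
    then have "h1 \<in> carrier G" "h2 \<in> carrier G" using gen by auto
    with eng.IH(1)[of g] eng.IH(2)[of "g \<otimes>\<^bsub>G\<^esub> h1"] eng.prems show ?case
      by (auto simp: m_assoc intro: pg.reachable_trans)
  qed
  have conn: "connected (with_proj (Cay G X))"
  proof (rule pg.connectedI)
    fix u v assume "u \<in> pverts (Cay G X)" "v \<in> pverts (Cay G X)"
    then have uv: "u \<in> carrier G" "v \<in> carrier G" by (auto simp: Cay_def)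
    then have "u \<rightarrow>\<^sup>*\<^bsub>with_proj (Cay G X)\<^esub> v"
      using reach[of "inv\<^bsub>G\<^esub> u \<otimes>\<^bsub>G\<^esub> v" u] gen by (simp flip: m_assoc)
    then show "u \<rightarrow>\<^sup>*\<^bsub>with_proj (mk_symmetric (with_proj (Cay G X)))\<^esub> v"
      by (rule pg.reachable_mk_symmetricI)
  qed (auto simp: Cay_def)
  have R: "?R (g, g \<otimes>\<^bsub>G\<^esub> x) = (g, g \<otimes>\<^bsub>G\<^esub> q x)" if "g \<in> carrier G" "x \<in> X" for g x
    using that X Dg by (auto simp: CM_def subset_iff simp flip: m_assoc)
  have qX: "q x \<in> X" if "x \<in> X" for x using that q by (simp add: permutes_in_image)
  have RD: "?R permutes ?D"
  proof (rule permutes_finite_inj[OF finD])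
    show "inj_on ?R ?D"
    proof (rule inj_onI, clarify)
      fix g h g' h' assume 1: "(g, h) \<in> ?D" "(g', h') \<in> ?D" "?R (g, h) = ?R (g', h')"
      then obtain x x' where *: "h = g \<otimes>\<^bsub>G\<^esub> x" "h' = g' \<otimes>\<^bsub>G\<^esub> x'" "x \<in> X" "x' \<in> X"
        "g \<in> carrier G" "g' \<in> carrier G" using D by metis
      with 1 have "g = g'" "g \<otimes>\<^bsub>G\<^esub> q x = g \<otimes>\<^bsub>G\<^esub> q x'" by (auto simp: R)
      with * X qX have "q x = q x'" by (metis Units_eq Units_l_cancel subsetD)
      with * \<open>g = g'\<close> show "g = g' \<and> h = h'" using permutes_inj[OF q] by (auto simp: inj_def)
    qed
    show "?R ` ?D \<subseteq> ?D"
    proof (rule image_subsetI)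
      fix d assume "d \<in> ?D"
      moreover obtain g h where d: "d = (g, h)" by force
      ultimately obtain x where "h = g \<otimes>\<^bsub>G\<^esub> x" "x \<in> X" "g \<in> carrier G" using D by metis
      then show "?R d \<in> ?D" using R Dg qX d by simp
    qed
  qed (auto simp: CM_def)
  have orb: "orbit ?R d = {e \<in> ?D. fst e = fst d}" if dD: "d \<in> ?D" for d
  proof -
    obtain g x where d: "d = (g, g \<otimes>\<^bsub>G\<^esub> x)" "g \<in> carrier G" "x \<in> X"
      using dD D[of "fst d" "snd d"] by (metis prod.collapse)
    have pow: "(?R ^^ k) d = (g, g \<otimes>\<^bsub>G\<^esub> (q ^^ k) x) \<and> (q ^^ k) x \<in> X" for k
      by (induction k) (auto simp: d R qX)
    have "orbit q x = X" using cyc d(3) by (auto simp: cyclic_on_alldef)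
    then have X': "X = {(q ^^ k) x |k. 0 < k}" by (simp add: orbit_altdef)
    have "orbit ?R d = {(g, g \<otimes>\<^bsub>G\<^esub> (q ^^ k) x) |k. 0 < k}"
      using pow by (simp add: orbit_altdef)
    also have "\<dots> = (\<lambda>y. (g, g \<otimes>\<^bsub>G\<^esub> y)) ` {(q ^^ k) x |k. 0 < k}" by blast
    also have "\<dots> = (\<lambda>y. (g, g \<otimes>\<^bsub>G\<^esub> y)) ` X" by (simp only: X'[symmetric])
    also have "\<dots> = {e \<in> ?D. fst e = fst d}"
    proof (intro Set.set_eqI iffI)
      fix e assume "e \<in> {e \<in> ?D. fst e = fst d}"
      then show "e \<in> (\<lambda>y. (g, g \<otimes>\<^bsub>G\<^esub> y)) ` X" using D[of g "snd e"] d by (cases e) auto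
    qed (use d Dg in auto)
    finally show ?thesis .
  qed
  have LD: "arev (CM G X q) permutes ?D"
    by (rule permutes_finite_inj[OF finD]) (auto simp: CM_def inj_on_def Dsym)
  show ?thesis
    unfolding is_map_def using pg conn RD orb LD by (auto simp: CM_def Dsym)
qed

section \<open>A regular 2-valent Cayley map on \<open>Dic 1\<close>\<close>

text \<open>
  \<open>Dic 1\<close> is the cyclic group of order 4 generated by \<open>b\<close>; with \<open>X = {b, inverse of b}\<close> and \<open>q\<close> the
  transposition, the Cayley map is the 4-cycle on the sphere, whose 8 automorphisms act regularly on
  its 8 arcs.  Hence the non-existence of regular Cayley maps of prime valency on dicyclic groups
  needs the pair \<open>p = 2\<close>, \<open>n = 1\<close> to be excluded.
\<close>

lemma cyclic4_regular:
  assumes G: "comm_group G" and c: "c \<in> carrier G" "c \<noteq> inv\<^bsub>G\<^esub> c"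
    and carr: "carrier G = {\<one>\<^bsub>G\<^esub>, c, c \<otimes>\<^bsub>G\<^esub> c, inv\<^bsub>G\<^esub> c}" and c4: "c \<otimes>\<^bsub>G\<^esub> c = inv\<^bsub>G\<^esub> c \<otimes>\<^bsub>G\<^esub> inv\<^bsub>G\<^esub> c"
  defines "X \<equiv> {c, inv\<^bsub>G\<^esub> c}"
  shows "\<exists>q. cayley_map_data G X q \<and> regular_map (CM G X q)"
proof -
  interpret comm_group G by (rule G)
  define q where "q = transpose c (inv\<^bsub>G\<^esub> c)"
  have q: "q x = inv\<^bsub>G\<^esub> x" if "x \<in> X" for x
    using that c by (auto simp: X_def q_def)
  have X: "x \<in> carrier G" "inv\<^bsub>G\<^esub> x \<in> X" if "x \<in> X" for x
    using that c by (auto simp: X_def)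
  have invX: "inv\<^bsub>G\<^esub> x \<in> X \<longleftrightarrow> x \<in> X" if "x \<in> carrier G" for x
    using that X by (metis inv_inv)
  have "q permutes X" unfolding q_def X_def by (rule permutes_swap_id) auto
  moreover have "cyclic_on q X"
  proof (rule cyclic_on_singleI)
    show "c \<in> X" by (simp add: X_def)
    have "q c \<in> orbit q c" "q (q c) \<in> orbit q c" by (auto intro: orbit.intros)
    moreover have "z \<in> X" if "z \<in> orbit q c" for z
      using that X by induction (simp_all add: q \<open>c \<in> X\<close>)
    ultimately show "X = orbit q c" by (auto simp: X_def q_def)
  qed
  moreover have "(\<lambda>x. inv\<^bsub>G\<^esub> x) ` X = X" using c by (auto simp: X_def)
  moreover have "\<one>\<^bsub>G\<^esub> \<notin> X" using c inv_one inv_inv[OF c(1)] by (metis X_def insertE singletonD)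
  moreover have "generate G X = carrier G"
  proof
    show "generate G X \<subseteq> carrier G" by (rule generate_incl) (use X in auto)
    have "\<one>\<^bsub>G\<^esub> \<in> generate G X" "c \<in> generate G X" "inv\<^bsub>G\<^esub> c \<in> generate G X"
      by (auto intro!: generate.one generate.incl simp: X_def)
    moreover from this have "c \<otimes>\<^bsub>G\<^esub> c \<in> generate G X" by (blast intro: generate.eng)
    ultimately show "carrier G \<subseteq> generate G X" using carr by auto
  qed
  ultimately have data: "cayley_map_data G X q"
    unfolding cayley_map_data_def using X is_group carr by auto
  let ?M = "CM G X q" and ?D = "parcs (Cay G X)"
  have D: "(x, y) \<in> ?D \<longleftrightarrow> x \<in> carrier G \<and> y \<in> carrier G \<and> inv\<^bsub>G\<^esub> x \<otimes>\<^bsub>G\<^esub> y \<in> X" for x y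
    by (simp add: Cay_def)
  have R: "rot ?M (x, y) = (x, x \<otimes>\<^bsub>G\<^esub> (x \<otimes>\<^bsub>G\<^esub> inv\<^bsub>G\<^esub> y))" if "(x, y) \<in> ?D" for x y
  proof -
    have "x \<in> carrier G" "y \<in> carrier G" "inv\<^bsub>G\<^esub> x \<otimes>\<^bsub>G\<^esub> y \<in> X" using that D by auto
    moreover from this have "inv\<^bsub>G\<^esub> (inv\<^bsub>G\<^esub> x \<otimes>\<^bsub>G\<^esub> y) = x \<otimes>\<^bsub>G\<^esub> inv\<^bsub>G\<^esub> y" by (simp add: inv_mult)
    ultimately show ?thesis using that by (simp add: CM_def q)
  qed
  have agree: "\<phi> z = \<psi> z"
    if \<phi>: "\<phi> \<in> map_automorphisms ?M" and \<psi>: "\<psi> \<in> map_automorphisms ?M" and xy: "(x, y) \<in> ?D"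
      and eq: "\<phi> x = \<psi> x" "\<phi> y = \<psi> y" for \<phi> \<psi> x y z
  proof (cases "z \<in> carrier G")
    case True
    have step: "\<phi> (u \<otimes>\<^bsub>G\<^esub> (u \<otimes>\<^bsub>G\<^esub> inv\<^bsub>G\<^esub> w)) = \<psi> (u \<otimes>\<^bsub>G\<^esub> (u \<otimes>\<^bsub>G\<^esub> inv\<^bsub>G\<^esub> w))"
      if "(u, w) \<in> ?D" "\<phi> u = \<psi> u" "\<phi> w = \<psi> w" for u w
    proof -
      have "graph ?M = Cay G X" by (simp add: CM_def)
      then have "map_prod \<phi> \<phi> (rot ?M (u, w)) = rot ?M (\<phi> u, \<phi> w)" "map_prod \<psi> \<psi> (rot ?M (u, w)) = rot ?M (\<psi> u, \<psi> w)"
        using \<phi> \<psi> that(1) by (auto simp: map_automorphisms_def)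
      with that show ?thesis by (simp add: R) (metis prod.inject)
    qed
    define s where "s = inv\<^bsub>G\<^esub> x \<otimes>\<^bsub>G\<^esub> y"
    have s: "s \<in> X" and x: "x \<in> carrier G" and y: "y \<in> carrier G" "y = x \<otimes>\<^bsub>G\<^esub> s"
      using xy D by (auto simp: s_def simp flip: m_assoc)
    have sc: "s \<in> carrier G" using s X by blast
    have yx: "(y, x) \<in> ?D"
      using x y(1) X(2)[OF s] by (simp add: D s_def inv_mult_group)
    have "inv\<^bsub>G\<^esub> x \<otimes>\<^bsub>G\<^esub> z \<in> {\<one>\<^bsub>G\<^esub>, s, s \<otimes>\<^bsub>G\<^esub> s, inv\<^bsub>G\<^esub> s}"
    proof -
      have "carrier G = {\<one>\<^bsub>G\<^esub>, s, s \<otimes>\<^bsub>G\<^esub> s, inv\<^bsub>G\<^esub> s}"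
      proof (cases "s = c")
        case False
        then have "s = inv\<^bsub>G\<^esub> c" using s by (simp add: X_def)
        then show ?thesis using carr c4 inv_inv[OF c(1)] by (metis insert_commute)
      qed (use carr in simp)
      moreover have "inv\<^bsub>G\<^esub> x \<otimes>\<^bsub>G\<^esub> z \<in> carrier G" using x True by simp
      ultimately show ?thesis by (simp only:)
    qed
    moreover have "z = x \<otimes>\<^bsub>G\<^esub> (inv\<^bsub>G\<^esub> x \<otimes>\<^bsub>G\<^esub> z)" using x True by (simp flip: m_assoc)
    ultimately have "z \<in> {x, x \<otimes>\<^bsub>G\<^esub> s, x \<otimes>\<^bsub>G\<^esub> (s \<otimes>\<^bsub>G\<^esub> s), x \<otimes>\<^bsub>G\<^esub> inv\<^bsub>G\<^esub> s}" using x by auto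
    moreover have "x \<otimes>\<^bsub>G\<^esub> (x \<otimes>\<^bsub>G\<^esub> inv\<^bsub>G\<^esub> y) = x \<otimes>\<^bsub>G\<^esub> inv\<^bsub>G\<^esub> s"
      using x y sc by (simp add: inv_mult) (simp flip: m_assoc)
    moreover have "y \<otimes>\<^bsub>G\<^esub> (y \<otimes>\<^bsub>G\<^esub> inv\<^bsub>G\<^esub> x) = x \<otimes>\<^bsub>G\<^esub> (s \<otimes>\<^bsub>G\<^esub> s)"
    proof -
      have "x \<otimes>\<^bsub>G\<^esub> s \<otimes>\<^bsub>G\<^esub> inv\<^bsub>G\<^esub> x = s" using x sc by (simp add: m_comm[of x s] m_assoc)
      then show ?thesis using x y(2) sc by (simp add: m_assoc)
    qed
    ultimately show ?thesis using step[OF xy eq] step[OF yx eq(2,1)] eq y(2) by auto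
  next
    case False
    then show ?thesis using \<phi> \<psi>
      by (auto simp: map_automorphisms_def graph_automorphisms_def CM_def Cay_def permutes_def)
  qed
  have ex: "\<exists>\<phi>. \<phi> \<in> map_automorphisms ?M \<and> \<phi> g = h \<and> \<phi> g' = h'"
    if gg: "(g, g') \<in> ?D" and hh: "(h, h') \<in> ?D" for g g' h h'
  proof -
    have cl: "g \<in> carrier G" "g' \<in> carrier G" "h \<in> carrier G" "h' \<in> carrier G"
      "inv\<^bsub>G\<^esub> g \<otimes>\<^bsub>G\<^esub> g' \<in> X" "inv\<^bsub>G\<^esub> h \<otimes>\<^bsub>G\<^esub> h' \<in> X" using gg hh D by auto
    define \<tau> where "\<tau> = (\<lambda>k x. if x \<in> carrier G then k \<otimes>\<^bsub>G\<^esub> x else x)"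
    define \<rho> where "\<rho> = (\<lambda>k x. if x \<in> carrier G then k \<otimes>\<^bsub>G\<^esub> inv\<^bsub>G\<^esub> x else x)"
    have perm: "f permutes carrier G"
      if "inj_on f (carrier G)" "f ` carrier G \<subseteq> carrier G" "\<And>x. x \<notin> carrier G \<Longrightarrow> f x = x" for f
      using that carr permutes_finite_inj[of "carrier G" f] by (metis finite.emptyI finite.insertI)
    have canc: "inv\<^bsub>G\<^esub> k \<otimes>\<^bsub>G\<^esub> (k \<otimes>\<^bsub>G\<^esub> z) = z" "k \<otimes>\<^bsub>G\<^esub> (inv\<^bsub>G\<^esub> k \<otimes>\<^bsub>G\<^esub> z) = z"
      if "k \<in> carrier G" "z \<in> carrier G" for k z using that by (simp_all flip: m_assoc)
    have t1: "inv\<^bsub>G\<^esub> (k \<otimes>\<^bsub>G\<^esub> x) \<otimes>\<^bsub>G\<^esub> (k \<otimes>\<^bsub>G\<^esub> y) = inv\<^bsub>G\<^esub> x \<otimes>\<^bsub>G\<^esub> y"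
      if "k \<in> carrier G" "x \<in> carrier G" "y \<in> carrier G" for k x y
      using that by (simp add: inv_mult_group m_assoc canc)
    have t2: "inv\<^bsub>G\<^esub> (k \<otimes>\<^bsub>G\<^esub> inv\<^bsub>G\<^esub> x) \<otimes>\<^bsub>G\<^esub> (k \<otimes>\<^bsub>G\<^esub> inv\<^bsub>G\<^esub> y) = inv\<^bsub>G\<^esub> (inv\<^bsub>G\<^esub> x \<otimes>\<^bsub>G\<^esub> y)"
      if "k \<in> carrier G" "x \<in> carrier G" "y \<in> carrier G" for k x y
      using that by (simp add: inv_mult_group m_assoc canc m_comm[of x "inv\<^bsub>G\<^esub> y"])
    have t3: "(k \<otimes>\<^bsub>G\<^esub> x) \<otimes>\<^bsub>G\<^esub> ((k \<otimes>\<^bsub>G\<^esub> x) \<otimes>\<^bsub>G\<^esub> inv\<^bsub>G\<^esub> (k \<otimes>\<^bsub>G\<^esub> y)) = k \<otimes>\<^bsub>G\<^esub> (x \<otimes>\<^bsub>G\<^esub> (x \<otimes>\<^bsub>G\<^esub> inv\<^bsub>G\<^esub> y))"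
      if "k \<in> carrier G" "x \<in> carrier G" "y \<in> carrier G" for k x y
    proof -
      have "(k \<otimes>\<^bsub>G\<^esub> x) \<otimes>\<^bsub>G\<^esub> inv\<^bsub>G\<^esub> (k \<otimes>\<^bsub>G\<^esub> y) = x \<otimes>\<^bsub>G\<^esub> inv\<^bsub>G\<^esub> y"
        using that by (simp add: inv_mult_group m_comm[of k x] m_assoc m_comm[of "inv\<^bsub>G\<^esub> y" "inv\<^bsub>G\<^esub> k"] canc)
      then show ?thesis using that by (simp add: m_assoc)
    qed
    have rel: "\<phi> \<in> map_automorphisms ?M"
      if "\<phi> permutes carrier G"
        and "\<And>x y. x \<in> carrier G \<Longrightarrow> y \<in> carrier G \<Longrightarrow> (\<phi> x, \<phi> y) \<in> ?D \<longleftrightarrow> (x, y) \<in> ?D"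
        and "\<And>x y. x \<in> carrier G \<Longrightarrow> y \<in> carrier G \<Longrightarrow>
          \<phi> (x \<otimes>\<^bsub>G\<^esub> (x \<otimes>\<^bsub>G\<^esub> inv\<^bsub>G\<^esub> y)) = \<phi> x \<otimes>\<^bsub>G\<^esub> (\<phi> x \<otimes>\<^bsub>G\<^esub> inv\<^bsub>G\<^esub> \<phi> y)" for \<phi>
    proof -
      have 1: "graph ?M = Cay G X" "pverts (Cay G X) = carrier G" by (simp_all add: CM_def Cay_def)
      have "map_prod \<phi> \<phi> (rot ?M (x, y)) = rot ?M (\<phi> x, \<phi> y)" if "(x, y) \<in> ?D" for x y
      proof -
        have "x \<in> carrier G" "y \<in> carrier G" using that D by auto
        with that \<open>\<And>x y. x \<in> carrier G \<Longrightarrow> y \<in> carrier G \<Longrightarrow> (\<phi> x, \<phi> y) \<in> ?D \<longleftrightarrow> (x, y) \<in> ?D\<close>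
          \<open>\<And>x y. x \<in> carrier G \<Longrightarrow> y \<in> carrier G \<Longrightarrow>
          \<phi> (x \<otimes>\<^bsub>G\<^esub> (x \<otimes>\<^bsub>G\<^esub> inv\<^bsub>G\<^esub> y)) = \<phi> x \<otimes>\<^bsub>G\<^esub> (\<phi> x \<otimes>\<^bsub>G\<^esub> inv\<^bsub>G\<^esub> \<phi> y)\<close>
        show ?thesis by (simp add: R)
      qed
      then show ?thesis using that(1,2) unfolding map_automorphisms_def graph_automorphisms_def 1 by auto
    qed
    have \<tau>: "\<tau> k \<in> map_automorphisms ?M" if "k \<in> carrier G" for k
    proof (rule rel)
      show "\<tau> k permutes carrier G"
        by (rule perm) (use that in \<open>auto simp: \<tau>_def inj_on_def\<close>)
    qed (use that in \<open>auto simp: \<tau>_def D t1 t3\<close>)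
    have \<rho>: "\<rho> k \<in> map_automorphisms ?M" if "k \<in> carrier G" for k
    proof (rule rel)
      show "\<rho> k permutes carrier G"
      proof (rule perm)
        show "inj_on (\<rho> k) (carrier G)"
          using that inv_inj by (simp add: \<rho>_def inj_on_def)
      qed (use that in \<open>auto simp: \<rho>_def\<close>)
      fix x y assume xy: "x \<in> carrier G" "y \<in> carrier G"
      show "(\<rho> k x, \<rho> k y) \<in> ?D \<longleftrightarrow> (x, y) \<in> ?D"
        using xy that by (simp add: \<rho>_def D t2 invX)
      have "inv\<^bsub>G\<^esub> (x \<otimes>\<^bsub>G\<^esub> (x \<otimes>\<^bsub>G\<^esub> inv\<^bsub>G\<^esub> y)) = inv\<^bsub>G\<^esub> x \<otimes>\<^bsub>G\<^esub> (inv\<^bsub>G\<^esub> x \<otimes>\<^bsub>G\<^esub> inv\<^bsub>G\<^esub> (inv\<^bsub>G\<^esub> y))"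
        using xy by (simp add: inv_mult)
      then show "\<rho> k (x \<otimes>\<^bsub>G\<^esub> (x \<otimes>\<^bsub>G\<^esub> inv\<^bsub>G\<^esub> y)) = \<rho> k x \<otimes>\<^bsub>G\<^esub> (\<rho> k x \<otimes>\<^bsub>G\<^esub> inv\<^bsub>G\<^esub> \<rho> k y)"
        using t3[OF that, of "inv\<^bsub>G\<^esub> x" "inv\<^bsub>G\<^esub> y"] xy that by (simp add: \<rho>_def)
    qed
    show ?thesis
    proof (cases "inv\<^bsub>G\<^esub> g \<otimes>\<^bsub>G\<^esub> g' = inv\<^bsub>G\<^esub> h \<otimes>\<^bsub>G\<^esub> h'")
      case True
      have "h \<otimes>\<^bsub>G\<^esub> inv\<^bsub>G\<^esub> g \<otimes>\<^bsub>G\<^esub> g' = h'" using cl True by (simp add: m_assoc canc)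
      then show ?thesis using cl \<tau>[of "h \<otimes>\<^bsub>G\<^esub> inv\<^bsub>G\<^esub> g"]
        by (intro exI[of _ "\<tau> (h \<otimes>\<^bsub>G\<^esub> inv\<^bsub>G\<^esub> g)"]) (simp add: \<tau>_def m_assoc)
    next
      case False
      then have "inv\<^bsub>G\<^esub> (inv\<^bsub>G\<^esub> g \<otimes>\<^bsub>G\<^esub> g') = inv\<^bsub>G\<^esub> h \<otimes>\<^bsub>G\<^esub> h'"
        using cl(5,6) c by (auto simp: X_def)
      then have "g \<otimes>\<^bsub>G\<^esub> inv\<^bsub>G\<^esub> g' = inv\<^bsub>G\<^esub> h \<otimes>\<^bsub>G\<^esub> h'"
        using cl by (simp add: inv_mult)
      then have "h \<otimes>\<^bsub>G\<^esub> g \<otimes>\<^bsub>G\<^esub> inv\<^bsub>G\<^esub> g' = h'" using cl by (simp add: m_assoc canc)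
      then show ?thesis using cl \<rho>[of "h \<otimes>\<^bsub>G\<^esub> g"]
        by (intro exI[of _ "\<rho> (h \<otimes>\<^bsub>G\<^esub> g)"]) (simp add: \<rho>_def m_assoc)
    qed
  qed
  have "regular_map ?M"
    unfolding regular_map_def
  proof (intro conjI ballI ex_ex1I)
    show "is_map ?M" using is_map_CM[OF data] .
    fix d e assume "d \<in> parcs (graph ?M)" "e \<in> parcs (graph ?M)"
    then have *: "(fst d, snd d) \<in> ?D" "(fst e, snd e) \<in> ?D" by (simp_all add: CM_def)
    show "\<exists>\<phi>. \<phi> \<in> map_automorphisms ?M \<and> map_prod \<phi> \<phi> d = e"
      using ex[OF *] by (metis map_prod_simp prod.collapse)
    fix \<phi> \<psi> assume "\<phi> \<in> map_automorphisms ?M \<and> map_prod \<phi> \<phi> d = e" "\<psi> \<in> map_automorphisms ?M \<and> map_prod \<psi> \<psi> d = e"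
    then have "\<phi> z = \<psi> z" for z
      using agree[of \<phi> \<psi> "fst d" "snd d" z] *(1) by (metis fst_map_prod snd_map_prod)
    then show "\<phi> = \<psi>" by blast
  qed
  with data show ?thesis by blast
qed

theorem regular_2_valent_Dic_1:
  "\<exists>X q. cayley_map_data (Dic 1) X q \<and> card X = 2 \<and> regular_map (CM (Dic 1) X q)"
proof -
  note One_nat_def[simp del]
  let ?S = "dic_relations 1" and ?w = "\<lambda>u. word_class (dic_relations 1) u"
  let ?b = "(DB, True)" and ?a = "(DA, True)"
  interpret group "Dic 1" by (rule group_Dic)
  define c where "c = ?w [?b]"
  have c: "c \<in> carrier (Dic 1)" by (simp add: c_def carrier_Dic)
  have bb: "word_eq ?S [?b, ?b] [?a]"
    using word_eq.relation[of "[?b, ?b]" "[?a]" ?S] by (simp add: dic_relations_def One_nat_def)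
  have cc: "c \<otimes>\<^bsub>Dic 1\<^esub> c = ?w [?a]"
    using bb by (simp add: c_def Dic_mult word_class_eq_iff)
  have aa: "word_eq ?S [?a, ?a] []"
    using word_eq.relation[of "[?a, ?a]" "[]" ?S] by (simp add: dic_relations_def numeral_2_eq_2 One_nat_def)
  have c4: "c \<otimes>\<^bsub>Dic 1\<^esub> c \<otimes>\<^bsub>Dic 1\<^esub> (c \<otimes>\<^bsub>Dic 1\<^esub> c) = \<one>\<^bsub>Dic 1\<^esub>"
    using aa by (simp add: cc Dic_mult Dic_one word_class_eq_iff)
  have ci: "inv\<^bsub>Dic 1\<^esub> c = c \<otimes>\<^bsub>Dic 1\<^esub> c \<otimes>\<^bsub>Dic 1\<^esub> c"
    using c c4 by (intro inv_equality) (auto simp: m_assoc)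
  have ab: "?w [?a, ?b] = inv\<^bsub>Dic 1\<^esub> c"
    unfolding ci cc by (simp add: c_def Dic_mult)
  have bij: "bij_betw (\<lambda>(k, e). ?w (dic_nf k e)) ({..<2} \<times> UNIV) (carrier (Dic 1))"
    using bij_betw_nf[of 1] by simp
  have nf: "dic_nf 0 False = []" "dic_nf 0 True = [?b]" "dic_nf 1 False = [?a]" "dic_nf 1 True = [?a, ?b]"
    by (simp_all add: dic_nf_def One_nat_def)
  have dom: "({..<2} \<times> UNIV :: (nat \<times> bool) set) = {(0, False), (0, True), (1, False), (1, True)}"
    by (auto simp: less_2_cases_iff)
  have carr: "carrier (Dic 1) = {\<one>\<^bsub>Dic 1\<^esub>, c, c \<otimes>\<^bsub>Dic 1\<^esub> c, inv\<^bsub>Dic 1\<^esub> c}"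
    using bij_betw_imp_surj_on[OF bij] unfolding dom
    by (simp add: nf ab Dic_one cc flip: c_def)
  have ne: "c \<noteq> inv\<^bsub>Dic 1\<^esub> c"
    using bij_betw_imp_inj_on[OF bij] unfolding dom inj_on_def
    by (simp add: nf ab flip: c_def)
  have "comm_group (Dic 1)"
  proof (rule group_comm_groupI)
    have 1: "inv\<^bsub>Dic 1\<^esub> c \<otimes>\<^bsub>Dic 1\<^esub> (c \<otimes>\<^bsub>Dic 1\<^esub> c) = c" "c \<otimes>\<^bsub>Dic 1\<^esub> c \<otimes>\<^bsub>Dic 1\<^esub> inv\<^bsub>Dic 1\<^esub> c = c"
      using c by (simp_all add: m_assoc) (simp flip: m_assoc)
    have 2: "c \<otimes>\<^bsub>Dic 1\<^esub> c \<otimes>\<^bsub>Dic 1\<^esub> c = c \<otimes>\<^bsub>Dic 1\<^esub> (c \<otimes>\<^bsub>Dic 1\<^esub> c)" using c by (simp add: m_assoc)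
    fix x y assume "x \<in> carrier (Dic 1)" "y \<in> carrier (Dic 1)"
    then have "x \<in> {\<one>\<^bsub>Dic 1\<^esub>, c, c \<otimes>\<^bsub>Dic 1\<^esub> c, inv\<^bsub>Dic 1\<^esub> c}" "y \<in> {\<one>\<^bsub>Dic 1\<^esub>, c, c \<otimes>\<^bsub>Dic 1\<^esub> c, inv\<^bsub>Dic 1\<^esub> c}"
      by (simp_all only: carr)
    then show "x \<otimes>\<^bsub>Dic 1\<^esub> y = y \<otimes>\<^bsub>Dic 1\<^esub> x"
      unfolding insert_iff empty_iff using c
      by (elim disjE FalseE) (simp_all add: 1 2)
  qed
  moreover have "c \<otimes>\<^bsub>Dic 1\<^esub> c = inv\<^bsub>Dic 1\<^esub> c \<otimes>\<^bsub>Dic 1\<^esub> inv\<^bsub>Dic 1\<^esub> c"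
  proof -
    have "c \<otimes>\<^bsub>Dic 1\<^esub> c = inv\<^bsub>Dic 1\<^esub> (c \<otimes>\<^bsub>Dic 1\<^esub> c)" using inv_equality[OF c4] c by simp
    then show ?thesis using c by (simp add: inv_mult_group)
  qed
  ultimately have "\<exists>q. cayley_map_data (Dic 1) {c, inv\<^bsub>Dic 1\<^esub> c} q \<and> regular_map (CM (Dic 1) {c, inv\<^bsub>Dic 1\<^esub> c} q)"
    using cyclic4_regular[OF _ c ne carr] by blast
  moreover have "card {c, inv\<^bsub>Dic 1\<^esub> c} = 2" using ne by simp
  ultimately show ?thesis by blast
qed

end

theory Submission
  imports Defs "HOL-Algebra.Zassenhaus" "HOL-Number_Theory.Cong"
begin

text \<open>
  If no element of \<open>X\<close> is an involution, then \<open>|X|\<close> is even, so \<open>X\<close> consists of an element and its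
  inverse and the group is cyclic, that is, \<open>n = 1\<close>.  Otherwise \<open>X\<close> contains the unique involution \<open>z\<close> of the dicyclic
  group, which is central.  Let \<open>H\<close> be the group of left translations, \<open>t \<in> H\<close> the translation by
  \<open>z\<close> and \<open>r\<close> the rotation of order \<open>p\<close> about the identity.  Since \<open>t\<close> reverses an arc at the
  identity, the automorphism group of the map is \<open>A = \<langle>r, t\<rangle> = \<langle>r\<rangle> H\<close>, and \<open>H\<close> is the centralizer of
  \<open>t\<close>.  A subgroup of a dicyclic group that avoids the involution is normal; as \<open>H\<close> is maximal in
  \<open>A\<close>, it follows that \<open>H\<close> meets each of its other conjugates in its core \<open>Z\<close>.  So \<open>A/Z\<close> acts on the
  \<open>p\<close> conjugates of \<open>t\<close> as a Frobenius group, and counting identifies its kernel as the image of \<open>\<langle>r\<rangle>\<close>.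
  Hence \<open>t\<close> normalizes \<open>E = \<langle>r\<rangle> Z\<close> and \<open>A = E \<union> E t\<close>, so \<open>E\<close> contains all squares, among them
  \<open>t = b\<^sup>2\<close>, which is impossible.
\<close>

text \<open>Together with \<open>m_assoc\<close> these rules bracket products to the right and
  cancel adjacent inverses, which decides most conjugation identities below.\<close>

lemma (in group) inv_cancel_left [simp]:
  "x \<in> carrier G \<Longrightarrow> y \<in> carrier G \<Longrightarrow> inv x \<otimes> (x \<otimes> y) = y"
  "x \<in> carrier G \<Longrightarrow> y \<in> carrier G \<Longrightarrow> x \<otimes> (inv x \<otimes> y) = y"
  by (simp_all flip: m_assoc)

section \<open>A non-existence theorem for factorizations of groups\<close>

text \<open>What enters about dicyclic groups is that the involution \<open>t\<close> is central,
  unique and a square, and that conjugation fixes or inverts every element whose square is not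
  \<open>t\<close>.\<close>

locale dicyclic_factorization = group G for G (structure) +
  fixes H and r t b and p :: nat
  assumes finite_carrier: "finite (carrier G)" and prime: "prime p"
    and subgroup_H: "subgroup H G"
    and r_closed: "r \<in> carrier G" and r_pow: "r [^] p = \<one>"
    and t: "t \<in> H" "t \<noteq> \<one>" "t \<otimes> t = \<one>"
    and b: "b \<in> H" "b \<otimes> b = t"
    and gen: "generate G {r, t} = carrier G"
    and factorization: "x \<in> carrier G \<Longrightarrow> \<exists>h\<in>H. \<exists>i::nat. x = h \<otimes> r [^] i"
    and meet: "r [^] (i::nat) \<in> H \<Longrightarrow> r [^] i = \<one>"
    and central: "h \<in> H \<Longrightarrow> h \<otimes> t = t \<otimes> h"
    and unique_involution: "h \<in> H \<Longrightarrow> h \<otimes> h = \<one> \<Longrightarrow> h = \<one> \<or> h = t"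
    and conj_H: "d \<in> H \<Longrightarrow> h \<in> H \<Longrightarrow> d \<otimes> d = t \<or> h \<otimes> d \<otimes> inv h \<in> {d, inv d}"
begin

section \<open>Powers of \<open>r\<close> and the factorization of the group\<close>

lemma H_closed: "h \<in> H \<Longrightarrow> h \<in> carrier G"
  using subgroup.mem_carrier[OF subgroup_H] .

lemma t_closed: "t \<in> carrier G" and b_closed: "b \<in> carrier G"
  using t b H_closed by auto

lemma inv_t: "inv t = t"
  using t t_closed by (simp add: inv_equality)

lemma r_pow_mod: "r [^] i = r [^] (i mod p)"
proof -
  have "r [^] i = r [^] (p * (i div p) + i mod p)" by simp
  also have "\<dots> = (r [^] p) [^] (i div p) \<otimes> r [^] (i mod p)"
    using r_closed by (simp only: nat_pow_mult nat_pow_pow nat_pow_closed)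
  finally show ?thesis using r_closed by (simp add: r_pow)
qed

text \<open>The cyclic group of \<open>r\<close>; natural exponents suffice because \<open>r\<close>
  has finite order.\<close>

definition P where "P = range (\<lambda>i::nat. r [^] i)"

lemma subgroup_P: "subgroup P G"
proof (rule subgroupI)
  fix x assume "x \<in> P"
  then obtain i :: nat where x: "x = r [^] i" by (auto simp: P_def)
  have "r [^] (i * (p - 1)) \<otimes> r [^] i = r [^] (i * p)"
    using r_closed prime_gt_0_nat[OF prime] by (cases p) (simp_all add: nat_pow_mult add.commute)
  also have "\<dots> = \<one>" using r_pow_mod[of "i * p"] by simp
  finally have "inv x = r [^] (i * (p - 1))" using x r_closed by (intro inv_equality) auto
  then show "inv x \<in> P" by (auto simp: P_def)
next
  fix x y assume "x \<in> P" "y \<in> P"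
  then show "x \<otimes> y \<in> P" using r_closed by (auto simp: P_def nat_pow_mult)
qed (use r_closed in \<open>auto simp: P_def\<close>)

text \<open>Inverting a factorization of \<open>inv x\<close> turns \<open>G = H P\<close> into
  \<open>G = P H\<close>.\<close>

lemma factor:
  assumes "x \<in> carrier G"
  shows "\<exists>(i::nat). \<exists>h\<in>H. x = r [^] i \<otimes> h"
proof -
  obtain h and i :: nat where hi: "h \<in> H" "inv x = h \<otimes> r [^] i"
    using factorization[of "inv x"] assms by auto
  have "r [^] i \<in> P" by (simp add: P_def)
  then obtain j :: nat where "inv (r [^] i) = r [^] j"
    using subgroup.m_inv_closed[OF subgroup_P] by (auto simp: P_def)
  moreover have "x = inv (r [^] i) \<otimes> inv h"
    using hi H_closed r_closed assms by (metis inv_inv inv_mult_group nat_pow_closed)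
  ultimately show ?thesis using subgroup.m_inv_closed[OF subgroup_H hi(1)] by metis
qed

lemma r_mem_P: "r \<in> P"
  unfolding P_def using r_closed by (auto intro!: image_eqI[of _ _ 1])

lemma subgroup_pow: "subgroup K G \<Longrightarrow> x \<in> K \<Longrightarrow> x [^] (i::nat) \<in> K"
  by (induction i) (auto simp: subgroup.one_closed subgroup.m_closed)

text \<open>As \<open>p\<close> is prime, \<open>i\<close> is invertible modulo \<open>p\<close>, so
  \<open>r\<close> is a power of \<open>r [^] i\<close>.\<close>

lemma r_mem_of_pow:
  assumes K: "subgroup K G" and i: "r [^] i \<in> K" "\<not> p dvd i"
  shows "r \<in> K"
proof -
  have "coprime i p" using prime_imp_coprime[OF prime i(2)] by (simp add: coprime_commute)
  then obtain j where "[i * j = 1] (mod p)" using cong_solve_coprime_nat by auto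
  then have "(i * j) mod p = 1" using prime_gt_1_nat[OF prime] by (simp add: cong_def)
  then have "(r [^] i) [^] j = r"
    using r_closed r_pow_mod[of "i * j"] by (simp add: nat_pow_pow)
  then show ?thesis using subgroup_pow[OF K i(1), of j] by simp
qed

text \<open>A subgroup \<open>E\<close> as below satisfies \<open>G = E \<union> E t\<close>, so it contains the square \<open>t\<close> of \<open>b\<close>.\<close>

lemma t_mem:
  assumes E: "subgroup E G" and r: "r \<in> E" and conj: "\<And>e. e \<in> E \<Longrightarrow> t \<otimes> e \<otimes> t \<in> E"
  shows "t \<in> E"
proof -
  note Ec = subgroup.mem_carrier[OF E] and Em = subgroup.m_closed[OF E]
  have tt: "t \<otimes> (t \<otimes> x) = x" if "x \<in> carrier G" for x
    using that t t_closed by (simp flip: m_assoc)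
  \<comment> \<open>The set \<open>E \<union> E t\<close> contains both generators and is closed
    under products, since \<open>t\<close> normalizes \<open>E\<close> and is its own
    inverse.\<close>
  have "x \<in> E \<or> x \<otimes> t \<in> E" if "x \<in> generate G {r, t}" for x
    using that
  proof induction
    case one
    show ?case using subgroup.one_closed[OF E] by simp
  next
    case (incl h)
    then show ?case using r t subgroup.one_closed[OF E] by auto
  next
    case (inv h)
    then show ?case using r t subgroup.one_closed[OF E] subgroup.m_inv_closed[OF E] by (auto simp: inv_t)
  next
    case (eng x y)
    then have xy: "x \<in> carrier G" "y \<in> carrier G" using gen by auto
    have 1: "x \<otimes> y = (x \<otimes> t) \<otimes> (t \<otimes> (y \<otimes> t) \<otimes> t)"
      and 2: "x \<otimes> y \<otimes> t = (x \<otimes> t) \<otimes> (t \<otimes> y \<otimes> t)"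
      and 3: "x \<otimes> y \<otimes> t = x \<otimes> (y \<otimes> t)"
      using xy t_closed tt t(3) by (simp_all add: m_assoc)
    from eng.IH show ?case
      using Em conj 1 2 3 by metis
  qed
  then consider "b \<in> E" | "b \<otimes> t \<in> E" using b_closed gen by auto
  then show ?thesis
  proof cases
    case 1
    then show ?thesis using Em[of b b] b by simp
  next
    case 2
    \<comment> \<open>The product of \<open>b t\<close> with its conjugate under \<open>t\<close> is
      \<open>b b = t\<close>, because the inner and outer factors \<open>t\<close> cancel.\<close>
    have "b \<otimes> t \<otimes> (t \<otimes> (b \<otimes> t) \<otimes> t) = t"
      using b_closed t_closed tt t(3) b(2) by (simp add: m_assoc)
    then show ?thesis using Em[OF 2 conj[OF 2]] by simp
  qed
qed

text \<open>If they commuted, \<open>t\<close> would normalize \<open>P\<close>, so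
  \<open>t_mem\<close> would put \<open>t\<close> into \<open>P \<inter> H\<close>, which is
  trivial.\<close>

lemma r_t_not_commute: "r \<otimes> t \<noteq> t \<otimes> r"
proof
  assume rt: "r \<otimes> t = t \<otimes> r"
  have "t \<otimes> r [^] i = r [^] i \<otimes> t" for i :: nat
  proof (induction i)
    case (Suc i)
    have "t \<otimes> r [^] Suc i = r [^] i \<otimes> (t \<otimes> r)"
      using r_closed t_closed Suc by (simp flip: m_assoc)
    then show ?case using r_closed t_closed by (simp add: m_assoc flip: rt)
  qed (use t_closed in simp)
  then have "t \<otimes> e \<otimes> t \<in> P" if "e \<in> P" for e
    using that t_closed r_closed t(3) by (auto simp: P_def m_assoc)
  from t_mem[OF subgroup_P r_mem_P this] show False
    using meet t by (auto simp: P_def)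
qed

lemma pow_mem_H: "r [^] i \<in> H \<Longrightarrow> p dvd i"
proof (rule ccontr)
  assume "r [^] i \<in> H" "\<not> p dvd i"
  from r_mem_of_pow[OF subgroup_H this] show False using central r_t_not_commute by blast
qed

lemma pow_mem_H_eq: "r [^] i \<in> H \<Longrightarrow> i < p \<Longrightarrow> i = 0"
  using pow_mem_H[of i] by (auto dest: dvd_imp_le)

section \<open>Maximality of \<open>H\<close> and the centralizer of \<open>t\<close>\<close>

text \<open>An element outside \<open>H\<close> has a nontrivial factor in \<open>P\<close>, and a
  nontrivial power of \<open>r\<close> yields \<open>r\<close> itself; so \<open>K\<close> contains
  both \<open>P\<close> and \<open>H\<close>.\<close>

lemma maximal:
  assumes K: "subgroup K G" and "H \<subseteq> K" and x: "x \<in> K" "x \<notin> H" and g: "g \<in> carrier G"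
  shows "g \<in> K"
proof -
  have "x \<in> carrier G" using subgroup.mem_carrier[OF K x(1)] .
  then obtain i :: nat and h where ih: "h \<in> H" "x = r [^] i \<otimes> h" using factor by blast
  then have "r [^] i = x \<otimes> inv h" using r_closed H_closed by (simp add: m_assoc)
  then have "r [^] i \<in> K"
    using ih(1) x(1) \<open>H \<subseteq> K\<close> subgroup.m_closed[OF K] subgroup.m_inv_closed[OF K] by (metis subsetD)
  moreover have "\<not> p dvd i"
  proof
    assume "p dvd i"
    then have "r [^] i = \<one>" using r_pow_mod[of i] by auto
    then show False using ih x(2) H_closed by simp
  qed
  ultimately have "r \<in> K" using r_mem_of_pow[OF K] by blast
  moreover obtain j :: nat and h' where "h' \<in> H" "g = r [^] j \<otimes> h'" using factor[OF g] by blast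
  ultimately show ?thesis
    using \<open>H \<subseteq> K\<close> subgroup.m_closed[OF K] subgroup_pow[OF K] by auto
qed

text \<open>The centralizer of \<open>t\<close> contains \<open>H\<close> but not \<open>r\<close>,
  so maximality leaves only \<open>H\<close>.\<close>

lemma centralizer_t:
  assumes "x \<in> carrier G" "x \<otimes> t = t \<otimes> x"
  shows "x \<in> H"
proof (rule ccontr)
  assume x: "x \<notin> H"
  define K where "K = {y \<in> carrier G. y \<otimes> t = t \<otimes> y}"
  have "subgroup K G"
  proof (rule subgroupI)
    fix y assume "y \<in> K"
    then have y: "y \<in> carrier G" "y \<otimes> t = t \<otimes> y" by (auto simp: K_def)
    have "t \<otimes> inv y = inv y \<otimes> (y \<otimes> t) \<otimes> inv y" using y(1) t_closed by (simp add: m_assoc)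
    also have "\<dots> = inv y \<otimes> t" unfolding y(2) using y(1) t_closed by (simp add: m_assoc)
    finally have "t \<otimes> inv y = inv y \<otimes> t" .
    then show "inv y \<in> K" using y by (simp add: K_def)
  next
    fix y z assume "y \<in> K" "z \<in> K"
    then have yz: "y \<in> carrier G" "y \<otimes> t = t \<otimes> y" "z \<in> carrier G" "z \<otimes> t = t \<otimes> z"
      by (auto simp: K_def)
    have "y \<otimes> z \<otimes> t = y \<otimes> (t \<otimes> z)" using yz(1,3) t_closed by (simp only: m_assoc yz(4))
    also have "\<dots> = t \<otimes> (y \<otimes> z)" using yz(1,3) t_closed by (simp only: yz(2) flip: m_assoc)
    finally show "y \<otimes> z \<in> K" using yz by (simp add: K_def)
  qed (use t_closed in \<open>auto simp: K_def\<close>)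
  moreover have "H \<subseteq> K" using central H_closed by (auto simp: K_def)
  moreover have "x \<in> K" using assms by (simp add: K_def)
  ultimately have "r \<in> K" using x r_closed by (rule maximal)
  then show False using r_t_not_commute by (simp add: K_def)
qed

text \<open>A conjugate of \<open>t\<close> is an involution, so inside \<open>H\<close> it could
  only be \<open>t\<close>; then \<open>x\<close> would centralize \<open>t\<close>.\<close>

lemma conj_t:
  assumes "x \<in> carrier G" "x \<notin> H"
  shows "x \<otimes> t \<otimes> inv x \<notin> H"
proof
  assume mem: "x \<otimes> t \<otimes> inv x \<in> H"
  have "x \<otimes> t \<otimes> inv x \<otimes> (x \<otimes> t \<otimes> inv x) = x \<otimes> (t \<otimes> t) \<otimes> inv x"
    using assms(1) t_closed by (simp add: m_assoc)
  also have "\<dots> = \<one>" using t assms(1) by simp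
  finally consider "x \<otimes> t \<otimes> inv x = \<one>" | "x \<otimes> t \<otimes> inv x = t"
    using unique_involution[OF mem] by blast
  then show False
  proof cases
    case 1
    have "t = inv x \<otimes> (x \<otimes> t \<otimes> inv x) \<otimes> x" using assms(1) t_closed by (simp add: m_assoc)
    then show False using 1 assms(1) t by simp
  next
    case 2
    have "x \<otimes> t = (x \<otimes> t \<otimes> inv x) \<otimes> x" using assms(1) t_closed by (simp add: m_assoc)
    then have "x \<otimes> t = t \<otimes> x" using 2 by simp
    then show False using centralizer_t assms by blast
  qed
qed

section \<open>The core of \<open>H\<close>\<close>

text \<open>The largest normal subgroup of \<open>G\<close> contained in \<open>H\<close>.\<close>

definition Z where "Z = {y \<in> H. \<forall>g\<in>carrier G. g \<otimes> y \<otimes> inv g \<in> H}"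

lemma conj_mult:
  "x \<in> carrier G \<Longrightarrow> y \<in> carrier G \<Longrightarrow> z \<in> carrier G \<Longrightarrow>
    x \<otimes> (y \<otimes> z) \<otimes> inv x = (x \<otimes> y \<otimes> inv x) \<otimes> (x \<otimes> z \<otimes> inv x)"
  by (simp add: m_assoc)

lemma conj_inv:
  "x \<in> carrier G \<Longrightarrow> y \<in> carrier G \<Longrightarrow> x \<otimes> inv y \<otimes> inv x = inv (x \<otimes> y \<otimes> inv x)"
  by (simp add: inv_mult_group m_assoc)

lemma conj_conj:
  "x \<in> carrier G \<Longrightarrow> y \<in> carrier G \<Longrightarrow> z \<in> carrier G \<Longrightarrow>
    x \<otimes> (y \<otimes> z \<otimes> inv y) \<otimes> inv x = (x \<otimes> y) \<otimes> z \<otimes> inv (x \<otimes> y)"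
  by (simp add: inv_mult_group m_assoc)


text \<open>\<open>H \<inter> x H x\<^sup>-\<^sup>1\<close> is normalized by \<open>H\<close> and centralized by the conjugate \<open>x t x\<^sup>-\<^sup>1\<close> outside \<open>H\<close>.\<close>

lemma mem_Z:
  assumes x: "x \<in> carrier G" "x \<notin> H" and y: "y \<in> H" "inv x \<otimes> y \<otimes> x \<in> H"
  shows "y \<in> Z"
proof -
  \<comment> \<open>\<open>D\<close> is the intersection of \<open>H\<close> with
    \<open>x H x^-1\<close>, and \<open>K\<close> is its normalizer; asking for both directions of
    conjugation makes \<open>K\<close> visibly closed under inverses.\<close>
  define D where "D = {y \<in> H. inv x \<otimes> y \<otimes> x \<in> H}"
  define K where "K = {g \<in> carrier G. \<forall>d\<in>D. g \<otimes> d \<otimes> inv g \<in> D \<and> inv g \<otimes> d \<otimes> g \<in> D}"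
  have Dc: "d \<in> carrier G" if "d \<in> D" for d using that H_closed by (auto simp: D_def)
  have Hi: "inv d \<in> H" if "d \<in> H" for d using subgroup.m_inv_closed[OF subgroup_H that] .
  have Di: "inv d \<in> D" if d: "d \<in> D" for d
  proof -
    have "inv x \<otimes> inv d \<otimes> x = inv (inv x \<otimes> d \<otimes> x)"
      using x Dc[OF d] by (simp add: inv_mult_group m_assoc)
    then show ?thesis using d Hi by (auto simp: D_def)
  qed
  have ix: "inv x \<notin> H" using Hi[of "inv x"] x by auto
  \<comment> \<open>Otherwise the square of \<open>inv x d x\<close> would be a conjugate of
    \<open>t\<close> lying in \<open>H\<close>, which \<open>conj_t\<close> forbids.\<close>
  have sq: "d \<otimes> d \<noteq> t" if d: "d \<in> D" for d
  proof
    assume "d \<otimes> d = t"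
    then have "inv x \<otimes> t \<otimes> inv (inv x) = inv x \<otimes> d \<otimes> x \<otimes> (inv x \<otimes> d \<otimes> x)"
      using x Dc[OF d] by (simp add: m_assoc flip: \<open>d \<otimes> d = t\<close>)
    moreover have "inv x \<otimes> d \<otimes> x \<otimes> (inv x \<otimes> d \<otimes> x) \<in> H"
      using d subgroup.m_closed[OF subgroup_H] by (simp add: D_def)
    ultimately show False using conj_t[of "inv x"] x ix by simp
  qed
  have K: "subgroup K G"
  proof (rule subgroupI)
    show "K \<noteq> {}" using Dc by (auto simp: K_def intro!: exI[of _ \<one>])
  next
    fix g assume "g \<in> K"
    then show "inv g \<in> K" by (simp add: K_def)
  next
    fix g h assume gh: "g \<in> K" "h \<in> K"
    then have "g \<in> carrier G" "h \<in> carrier G" by (auto simp: K_def)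
    then have "g \<otimes> h \<otimes> d \<otimes> inv (g \<otimes> h) = g \<otimes> (h \<otimes> d \<otimes> inv h) \<otimes> inv g"
      "inv (g \<otimes> h) \<otimes> d \<otimes> (g \<otimes> h) = inv h \<otimes> (inv g \<otimes> d \<otimes> g) \<otimes> h" if "d \<in> D" for d
      using Dc[OF that] by (simp_all add: inv_mult_group m_assoc)
    then show "g \<otimes> h \<in> K" using gh by (simp add: K_def)
  qed (auto simp: K_def)
  \<comment> \<open>With \<open>sq\<close> excluding the first alternative of \<open>conj_H\<close>,
    conjugation by \<open>H\<close> sends \<open>d\<close> to \<open>d\<close> or to its
    inverse.\<close>
  have conj_D: "h \<otimes> d \<otimes> inv h \<in> D" if "d \<in> D" "h \<in> H" for d h
    using conj_H[of d h] sq[OF that(1)] that Di[OF that(1)] by (auto simp: D_def)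
  have "H \<subseteq> K"
  proof
    fix h assume h: "h \<in> H"
    show "h \<in> K"
      using conj_D[OF _ h] conj_D[OF _ Hi[OF h]] H_closed[OF h] by (simp add: K_def)
  qed
  moreover have "x \<otimes> t \<otimes> inv x \<in> K"
  proof -
    let ?u = "x \<otimes> t \<otimes> inv x"
    have u: "?u \<in> carrier G" "inv ?u = ?u"
      using x t_closed by (simp_all add: inv_mult_group m_assoc inv_t)
    \<comment> \<open>Conjugating back by \<open>x\<close> turns this into the fact that the element
      \<open>inv x d x\<close> of \<open>H\<close> commutes with \<open>t\<close>.\<close>
    have "?u \<otimes> d \<otimes> ?u = d" if d: "d \<in> D" for d
    proof -
      let ?e = "inv x \<otimes> d \<otimes> x"
      have e: "?e \<in> carrier G" "?e \<otimes> t = t \<otimes> ?e" using x Dc[OF d] d central by (auto simp: D_def)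
      have "?u \<otimes> d \<otimes> ?u = x \<otimes> (t \<otimes> (?e \<otimes> t)) \<otimes> inv x"
        using x t_closed Dc[OF d] by (simp add: m_assoc)
      also have "\<dots> = x \<otimes> (t \<otimes> t \<otimes> ?e) \<otimes> inv x"
        unfolding e(2) using x t_closed e(1) by (simp only: m_assoc)
      also have "\<dots> = d" unfolding t(3) using x Dc[OF d] by (simp add: m_assoc)
      finally show ?thesis .
    qed
    then show ?thesis using u by (simp add: K_def)
  qed
  \<comment> \<open>\<open>K\<close> contains \<open>H\<close> and an element outside
    \<open>H\<close>, hence everything; so all conjugates of \<open>y\<close> stay in
    \<open>D\<close>, a subset of \<open>H\<close>.\<close>
  ultimately have "g \<in> K" if "g \<in> carrier G" for g
    using maximal[OF K] conj_t[OF x] that by blast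
  then have "g \<otimes> y \<otimes> inv g \<in> H" if "g \<in> carrier G" for g
    using y that by (auto simp: K_def D_def)
  then show ?thesis using y by (simp add: Z_def)
qed

lemma Z_closed: "z \<in> Z \<Longrightarrow> z \<in> carrier G"
  using H_closed by (auto simp: Z_def)

lemma conj_Z: "g \<in> carrier G \<Longrightarrow> z \<in> Z \<Longrightarrow> g \<otimes> z \<otimes> inv g \<in> Z"
proof -
  assume g: "g \<in> carrier G" and z: "z \<in> Z"
  have "x \<otimes> (g \<otimes> z \<otimes> inv g) \<otimes> inv x \<in> H" if x: "x \<in> carrier G" for x
    unfolding conj_conj[OF x g Z_closed[OF z]] using z g x by (simp add: Z_def)
  then show ?thesis using g z by (simp add: Z_def)
qed

lemma normal_Z: "Z \<lhd> G"
  unfolding normal_inv_iff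
proof (intro conjI ballI conj_Z)
  show "subgroup Z G"
  proof (rule subgroupI)
    show "Z \<noteq> {}" using subgroup.one_closed[OF subgroup_H] by (auto simp: Z_def intro!: exI[of _ \<one>])
  next
    fix z assume z: "z \<in> Z"
    have "g \<otimes> inv z \<otimes> inv g \<in> H" if g: "g \<in> carrier G" for g
      unfolding conj_inv[OF g Z_closed[OF z]] using z g subgroup.m_inv_closed[OF subgroup_H] by (simp add: Z_def)
    then show "inv z \<in> Z" using z subgroup.m_inv_closed[OF subgroup_H] by (simp add: Z_def)
  next
    fix y z assume yz: "y \<in> Z" "z \<in> Z"
    have "g \<otimes> (y \<otimes> z) \<otimes> inv g \<in> H" if g: "g \<in> carrier G" for g
      unfolding conj_mult[OF g yz[THEN Z_closed]] using yz g subgroup.m_closed[OF subgroup_H] by (simp add: Z_def)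
    then show "y \<otimes> z \<in> Z" using yz subgroup.m_closed[OF subgroup_H] by (simp add: Z_def)
  qed (use Z_closed in auto)
qed

lemma t_notin_Z: "t \<notin> Z"
proof
  assume "t \<in> Z"
  then have "r \<otimes> t \<otimes> inv r \<in> H" using r_closed by (simp add: Z_def)
  then have "r \<in> H" using conj_t r_closed by blast
  then show False using central r_t_not_commute by blast
qed

section \<open>The Frobenius kernel and the counting argument\<close>

text \<open>The preimage in \<open>G\<close> of the Frobenius kernel of \<open>G/Z\<close>; it is a
  subgroup since \<open>Z\<close> is normal.\<close>

definition E where "E = P <#> Z"

lemma E_iff: "x \<in> E \<longleftrightarrow> (\<exists>i::nat. \<exists>z\<in>Z. x = r [^] i \<otimes> z)"
  by (auto simp: E_def P_def set_mult_def)

lemma subgroup_E: "subgroup E G"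
  unfolding E_def using subgroup_P commut_normal[OF subgroup_P normal_Z] mult_norm_subgroup[OF normal_Z subgroup_P] by simp

lemma pow_diff: "i \<le> j \<Longrightarrow> inv (r [^] i) \<otimes> r [^] (j::nat) = r [^] (j - i)"
  using r_closed nat_pow_mult[of r i "j - i"] by (metis inv_cancel_left(1) le_add_diff_inverse nat_pow_closed)

text \<open>
  The conjugates of \<open>H - Z\<close> are disjoint and miss \<open>E\<close>; counting shows that nothing else is left.
\<close>

lemma mem_E_or_conj:
  assumes x: "x \<in> carrier G"
  shows "x \<in> E \<or> (\<exists>(i::nat). \<exists>h\<in>H. x = r [^] i \<otimes> h \<otimes> inv (r [^] i))"
proof -
  let ?c = "\<lambda>(i::nat) h. r [^] i \<otimes> h \<otimes> inv (r [^] i)"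
  have ZH: "Z \<subseteq> H" by (auto simp: Z_def)
  have fin: "finite H" "finite Z" "finite E"
    using finite_subset[OF _ finite_carrier] H_closed Z_closed subgroup.subset[OF subgroup_E] by blast+
  \<comment> \<open>Every conjugate of \<open>H - Z\<close> occurs here, because
    \<open>G = P H\<close> and \<open>H\<close> normalizes both \<open>H\<close> and
    \<open>Z\<close>.\<close>
  define B where "B = (\<Union>i<p. ?c i ` (H - Z))"
  have inj: "inj_on (?c i) (carrier G)" for i
    using r_closed by (auto simp: inj_on_def)
  \<comment> \<open>With \<open>x = r^(j-i)\<close>, which is outside \<open>H\<close>, an equality
    would put both \<open>h'\<close> and \<open>x h' x^-1\<close> into \<open>H\<close>, so
    \<open>mem_Z\<close> would put \<open>h'\<close> into \<open>Z\<close>.\<close>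
  have lt: "?c i h \<noteq> ?c j h'" if "i < j" "j < p" "h \<in> H" "h' \<in> H - Z" for i j h h'
  proof
    assume eq: "?c i h = ?c j h'"
    have hc: "h \<in> carrier G" "h' \<in> carrier G" using that H_closed by auto
    let ?x = "r [^] (j - i)"
    have x: "?x = inv (r [^] i) \<otimes> r [^] j" using pow_diff[of i j] that by simp
    have "h = inv (r [^] i) \<otimes> ?c i h \<otimes> r [^] i" using hc r_closed by (simp add: m_assoc)
    also have "\<dots> = ?x \<otimes> h' \<otimes> inv ?x" unfolding eq x using hc r_closed by (simp add: m_assoc inv_mult_group)
    finally have "?x \<otimes> h' \<otimes> inv ?x \<in> H" using that by simp
    then have "inv (inv ?x) \<otimes> h' \<otimes> inv ?x \<in> H" using r_closed by simp
    moreover have "?x \<notin> H" using pow_mem_H_eq[of "j - i"] that less_imp_diff_less[of j p i] by auto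
    then have "inv ?x \<notin> H" using subgroup.m_inv_closed[OF subgroup_H, of "inv ?x"] r_closed by auto
    ultimately have "h' \<in> Z" using mem_Z[of "inv ?x" h'] r_closed that by simp
    then show False using that by simp
  qed
  have disj: "?c i ` (H - Z) \<inter> ?c j ` (H - Z) = {}" if "i < p" "j < p" "i \<noteq> j" for i j
    using that lt[of i j] lt[of j i] by (cases i j rule: linorder_cases) (auto, metis+)
  have "card B = (\<Sum>i<p. card (?c i ` (H - Z)))"
    unfolding B_def using fin disj by (intro card_UN_disjoint) auto
  also have "\<dots> = p * (card H - card Z)"
    using inj_on_subset[OF inj] H_closed fin ZH
    by (simp add: card_image subset_iff card_Diff_subset)
  finally have cB: "card B = p * (card H - card Z)" .
  \<comment> \<open>Uniqueness of the factorization in \<open>P H\<close> is used twice: on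
    \<open>H\<close> for the order of \<open>G\<close> and on \<open>Z\<close> for the order of
    \<open>E\<close>.\<close>
  have inj2: "inj_on (\<lambda>(i, h). r [^] i \<otimes> h) ({..<p} \<times> H)"
  proof -
    have lt2: "r [^] i \<otimes> h \<noteq> r [^] j \<otimes> h'" if "i < j" "j < p" "h \<in> H" "h' \<in> H" for i j :: nat and h h'
    proof
      assume eq: "r [^] i \<otimes> h = r [^] j \<otimes> h'"
      have hc: "h \<in> carrier G" "h' \<in> carrier G" using that H_closed by auto
      have "h = inv (r [^] i) \<otimes> (r [^] i \<otimes> h)" using hc r_closed by simp
      also have "\<dots> = r [^] (j - i) \<otimes> h'"
        unfolding eq using hc r_closed that(1) by (simp add: m_assoc flip: pow_diff)
      finally have "r [^] (j - i) = h \<otimes> inv h'" using hc r_closed by (simp add: m_assoc)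
      then have "r [^] (j - i) \<in> H"
        using that subgroup.m_closed[OF subgroup_H] subgroup.m_inv_closed[OF subgroup_H] by simp
      then show False using pow_mem_H_eq[of "j - i"] that less_imp_diff_less[of j p i] by auto
    qed
    show ?thesis
    proof (rule inj_onI, clarify)
      fix i h j h' assume *: "i < p" "h \<in> H" "j < p" "h' \<in> H" and eq: "r [^] i \<otimes> h = r [^] j \<otimes> h'"
      then have "i = j" using lt2[of i j h h'] lt2[of j i h' h] by (metis linorder_neqE_nat)
      then show "i = j \<and> h = h'" using eq * H_closed r_closed by auto
    qed
  qed
  have im: "\<exists>i<p. r [^] j = r [^] i" for j :: nat
    using r_pow_mod[of j] prime_gt_0_nat[OF prime] by (meson mod_less_divisor)
  have "carrier G = (\<lambda>(i, h). r [^] i \<otimes> h) ` ({..<p} \<times> H)"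
  proof (intro equalityI subsetI)
    fix x assume "x \<in> carrier G"
    then obtain j :: nat and h where "h \<in> H" "x = r [^] j \<otimes> h" using factor by blast
    then show "x \<in> (\<lambda>(i, h). r [^] i \<otimes> h) ` ({..<p} \<times> H)" using im[of j] by force
  qed (use r_closed H_closed in auto)
  then have cG: "card (carrier G) = p * card H"
    using card_image[OF inj2] by (simp add: card_cartesian_product)
  have "E = (\<lambda>(i, h). r [^] i \<otimes> h) ` ({..<p} \<times> Z)"
  proof (intro equalityI subsetI)
    fix x assume "x \<in> E"
    then obtain j :: nat and h where "h \<in> Z" "x = r [^] j \<otimes> h" using E_iff by blast
    then show "x \<in> (\<lambda>(i, h). r [^] i \<otimes> h) ` ({..<p} \<times> Z)" using im[of j] by force
  qed (auto simp: E_iff)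
  then have cE: "card E = p * card Z"
    using card_image[OF inj_on_subset[OF inj2, of "{..<p} \<times> Z"]] ZH by (auto simp: card_cartesian_product)
  \<comment> \<open>If the conjugate of \<open>h\<close> under \<open>r^i\<close> is
    \<open>r^j z\<close>, then, \<open>P\<close> being abelian, \<open>h = r^j z'\<close> with
    \<open>z'\<close> in \<open>Z\<close>. So \<open>r^j\<close> lies in \<open>H\<close>, is
    trivial, and \<open>h\<close> lies in \<open>Z\<close>.\<close>
  have BE: "B \<inter> E = {}"
  proof (rule ccontr)
    assume "B \<inter> E \<noteq> {}"
    then obtain i h where ih: "h \<in> H" "h \<notin> Z" "?c i h \<in> E" by (auto simp: B_def)
    then obtain j :: nat and z where jz: "z \<in> Z" "?c i h = r [^] j \<otimes> z" using E_iff by blast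
    have hc: "h \<in> carrier G" "z \<in> carrier G" using ih jz H_closed Z_closed by auto
    let ?z = "inv (r [^] i) \<otimes> z \<otimes> r [^] i"
    have z: "?z \<in> Z" using conj_Z[OF _ jz(1), of "inv (r [^] i)"] r_closed by simp
    have "h = inv (r [^] i) \<otimes> ?c i h \<otimes> r [^] i" using hc r_closed by (simp add: m_assoc)
    also have "\<dots> = inv (r [^] i) \<otimes> (r [^] j \<otimes> r [^] i) \<otimes> ?z"
      unfolding jz(2) using hc r_closed by (simp add: m_assoc)
    also have "r [^] j \<otimes> r [^] i = r [^] i \<otimes> r [^] j"
      using r_closed by (simp add: nat_pow_mult add.commute)
    finally have h: "h = r [^] j \<otimes> ?z" using hc r_closed by simp
    then have "r [^] j = h \<otimes> inv ?z" using Z_closed[OF z] r_closed by (metis inv_solve_right nat_pow_closed hc(1))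
    moreover have "\<dots> \<in> H"
      using ih z ZH subgroup.m_closed[OF subgroup_H] subgroup.m_inv_closed[OF subgroup_H] by blast
    ultimately have "r [^] j \<in> H" by simp
    then have "r [^] j = \<one>" by (rule meet)
    then have "h = ?z" using h Z_closed[OF z] by simp
    then show False using z ih by simp
  qed
  have "B \<subseteq> carrier G" using r_closed H_closed by (auto simp: B_def)
  moreover have "E \<subseteq> carrier G" using subgroup.subset[OF subgroup_E] .
  moreover have "finite B" using fin by (auto simp: B_def)
  \<comment> \<open>Subtraction of naturals is truncated, so
    \<open>p (|H| - |Z|) + p |Z| = p |H|\<close> relies on this inequality.\<close>
  moreover have "card Z \<le> card H" using card_mono[OF fin(1) ZH] .
  then have "p * (card H - card Z) + p * card Z = p * card H"
    by (simp flip: add_mult_distrib2)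
  ultimately have "B \<union> E = carrier G"
    using card_subset_eq[OF finite_carrier, of "B \<union> E"] card_Un_disjoint[OF _ fin(3) BE] cB cE cG
    by simp
  then show ?thesis using x by (auto simp: B_def)
qed

text \<open>Outside \<open>E\<close> the element \<open>t r t\<close> would be conjugate into
  \<open>H\<close>, hence so would \<open>r\<close>. By \<open>G = P H\<close> the conjugator can be
  taken to be a power of \<open>r\<close>, which commutes with \<open>r\<close>, so \<open>r\<close>
  itself would lie in \<open>H\<close>.\<close>

lemma conj_r_mem_E: "t \<otimes> r \<otimes> t \<in> E"
proof (rule ccontr)
  assume "t \<otimes> r \<otimes> t \<notin> E"
  then obtain i :: nat and h where h: "h \<in> H" "t \<otimes> r \<otimes> t = r [^] i \<otimes> h \<otimes> inv (r [^] i)"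
    using mem_E_or_conj[of "t \<otimes> r \<otimes> t"] r_closed t_closed by auto
  obtain j :: nat and k where k: "k \<in> H" "t \<otimes> r [^] i = r [^] j \<otimes> k"
    using factor[of "t \<otimes> r [^] i"] r_closed t_closed by auto
  have c: "h \<in> carrier G" "k \<in> carrier G" using h k H_closed by auto
  have tt: "t \<otimes> (t \<otimes> x) = x" if "x \<in> carrier G" for x
    using that t t_closed by (simp flip: m_assoc)
  have "r = t \<otimes> (t \<otimes> r \<otimes> t) \<otimes> t" using r_closed t_closed t by (simp add: m_assoc tt)
  also have "\<dots> = (t \<otimes> r [^] i) \<otimes> h \<otimes> inv (t \<otimes> r [^] i)"
    unfolding h(2) using r_closed t_closed c by (simp add: m_assoc inv_mult_group inv_t)
  also have "\<dots> = r [^] j \<otimes> (k \<otimes> h \<otimes> inv k) \<otimes> inv (r [^] j)"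
    unfolding k(2) using r_closed t_closed c by (simp add: m_assoc inv_mult_group)
  finally have eq: "r = r [^] j \<otimes> (k \<otimes> h \<otimes> inv k) \<otimes> inv (r [^] j)" .
  have "r = inv (r [^] j) \<otimes> (r \<otimes> r [^] j)"
    using r_closed nat_pow_comm[of r 1 j] by simp
  also have "\<dots> = inv (r [^] j) \<otimes> (r [^] j \<otimes> (k \<otimes> h \<otimes> inv k) \<otimes> inv (r [^] j) \<otimes> r [^] j)"
    using eq by simp
  also have "\<dots> = k \<otimes> h \<otimes> inv k"
    using r_closed c by (simp add: m_assoc)
  also have "\<dots> \<in> H"
    using h k subgroup.m_closed[OF subgroup_H] subgroup.m_inv_closed[OF subgroup_H] by simp
  finally have "r \<in> H" .
  then show False using central r_t_not_commute by blast
qed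

text \<open>Conjugation by \<open>t\<close> is multiplicative, so it suffices to treat
  \<open>r\<close> and the normal subgroup \<open>Z\<close>.\<close>

lemma conj_mem_E:
  assumes "e \<in> E"
  shows "t \<otimes> e \<otimes> t \<in> E"
proof -
  obtain i :: nat and z where iz: "z \<in> Z" "e = r [^] i \<otimes> z" using assms E_iff by blast
  have tt: "t \<otimes> (t \<otimes> x) = x" if "x \<in> carrier G" for x
    using that t t_closed by (simp flip: m_assoc)
  have pow: "t \<otimes> r [^] i \<otimes> t \<in> E" for i :: nat
  proof (induction i)
    case 0
    show ?case using t t_closed subgroup.one_closed[OF subgroup_E] by simp
  next
    case (Suc i)
    have "t \<otimes> r [^] Suc i \<otimes> t = (t \<otimes> r [^] i \<otimes> t) \<otimes> (t \<otimes> r \<otimes> t)"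
      using r_closed t_closed by (simp add: m_assoc tt)
    then show ?case using subgroup.m_closed[OF subgroup_E Suc conj_r_mem_E] by simp
  qed
  have "t \<otimes> z \<otimes> t \<in> Z" using conj_Z[OF t_closed iz(1)] by (simp add: inv_t)
  then have "t \<otimes> z \<otimes> t \<in> E" using E_iff
    by (metis Z_closed l_one nat_pow_0)
  from subgroup.m_closed[OF subgroup_E pow[of i] this]
  show ?thesis using r_closed t_closed Z_closed[OF iz(1)] by (simp add: m_assoc tt iz(2))
qed

text \<open>Once \<open>t\<close> is in \<open>E = P Z\<close>, its factor in \<open>P\<close> lies
  in \<open>H\<close> and is trivial, so \<open>t\<close> lies in \<open>Z\<close>, against
  \<open>t_notin_Z\<close>.\<close>

theorem contradiction: False
proof -
  have "r \<in> E"
    using r_closed E_iff subgroup.one_closed[OF normal_imp_subgroup[OF normal_Z]]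
    by (metis nat_pow_0 nat_pow_Suc l_one r_one)
  then obtain i :: nat and z where iz: "z \<in> Z" "t = r [^] i \<otimes> z"
    using t_mem[OF subgroup_E _ conj_mem_E] E_iff by blast
  have "z \<in> H" using iz(1) unfolding Z_def by blast
  then have z: "z \<in> H" "z \<in> carrier G" using H_closed by blast+
  have "r [^] i = t \<otimes> inv z" using z iz(2) r_closed by (simp add: m_assoc)
  also have "\<dots> \<in> H"
    using t z subgroup.m_closed[OF subgroup_H] subgroup.m_inv_closed[OF subgroup_H] by simp
  finally have "t = z" using meet[of i] iz(2) z by simp
  then show False using iz t_notin_Z by simp
qed

end

section \<open>Automorphisms of regular Cayley maps\<close>

definition aut_group :: "'v graph_map \<Rightarrow> ('v \<Rightarrow> 'v) monoid" where
  "aut_group M = \<lparr>carrier = map_automorphisms M, mult = (\<circ>), one = id\<rparr>"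

lemma aut_group_simps [simp]:
  "carrier (aut_group M) = map_automorphisms M"
  "\<phi> \<otimes>\<^bsub>aut_group M\<^esub> \<psi> = \<phi> \<circ> \<psi>"
  "\<one>\<^bsub>aut_group M\<^esub> = id"
  by (simp_all add: aut_group_def)

lemma aut_group_pow: "\<phi> [^]\<^bsub>aut_group M\<^esub> (k::nat) = \<phi> ^^ k"
  by (induction k) (auto simp: nat_pow_def funpow_Suc_right simp del: funpow.simps(2))

lemma map_automorphismsI:
  assumes "\<phi> permutes pverts (graph M)"
    and "\<And>x y. x \<in> pverts (graph M) \<Longrightarrow> y \<in> pverts (graph M) \<Longrightarrow>
      (\<phi> x, \<phi> y) \<in> parcs (graph M) \<longleftrightarrow> (x, y) \<in> parcs (graph M)"
    and "\<And>x y. (x, y) \<in> parcs (graph M) \<Longrightarrow> map_prod \<phi> \<phi> (rot M (x, y)) = rot M (\<phi> x, \<phi> y)"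
  shows "\<phi> \<in> map_automorphisms M"
  using assms by (auto simp: map_automorphisms_def graph_automorphisms_def)

lemma group_aut_group:
  assumes "is_map M"
  shows "group (aut_group M)"
proof -
  interpret pair_graph "graph M" using assms by (simp add: is_map_def)
  note wf = in_arcsD1 in_arcsD2
  have comp: "\<phi> \<circ> \<psi> \<in> map_automorphisms M"
    if \<phi>: "\<phi> \<in> map_automorphisms M" and \<psi>: "\<psi> \<in> map_automorphisms M" for \<phi> \<psi>
  proof (rule map_automorphismsI)
    have p: "\<phi> permutes pverts (graph M)" "\<psi> permutes pverts (graph M)"
      using that by (auto simp: map_automorphisms_def graph_automorphisms_def)
    then show "\<phi> \<circ> \<psi> permutes pverts (graph M)" by (simp add: permutes_compose)
    note m = permutes_in_image[OF p(2)]
    show "((\<phi> \<circ> \<psi>) x, (\<phi> \<circ> \<psi>) y) \<in> parcs (graph M) \<longleftrightarrow> (x, y) \<in> parcs (graph M)"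
      if "x \<in> pverts (graph M)" "y \<in> pverts (graph M)" for x y
      using that m \<phi> \<psi> by (auto simp: map_automorphisms_def graph_automorphisms_def)
    fix x y assume xy: "(x, y) \<in> parcs (graph M)"
    then have "(\<psi> x, \<psi> y) \<in> parcs (graph M)"
      using \<psi> wf[OF xy] by (auto simp: map_automorphisms_def graph_automorphisms_def)
    then have "map_prod \<phi> \<phi> (rot M (\<psi> x, \<psi> y)) = rot M (\<phi> (\<psi> x), \<phi> (\<psi> y))"
      using \<phi> by (auto simp: map_automorphisms_def)
    moreover have "map_prod \<psi> \<psi> (rot M (x, y)) = rot M (\<psi> x, \<psi> y)"
      using \<psi> xy by (auto simp: map_automorphisms_def)
    ultimately show "map_prod (\<phi> \<circ> \<psi>) (\<phi> \<circ> \<psi>) (rot M (x, y)) = rot M ((\<phi> \<circ> \<psi>) x, (\<phi> \<circ> \<psi>) y)"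
      by (metis comp_apply map_prod_compose)
  qed
  show ?thesis
  proof (rule groupI)
    fix \<phi> assume "\<phi> \<in> carrier (aut_group M)"
    then have \<phi>: "\<phi> \<in> map_automorphisms M" by simp
    then have p: "\<phi> permutes pverts (graph M)" 
      by (auto simp: map_automorphisms_def graph_automorphisms_def)
    have pi: "inv_into UNIV \<phi> permutes pverts (graph M)" using p by (rule permutes_inv)
    note m = permutes_in_image[OF pi] and inv = permutes_inverses[OF p]
    have arc: "(inv_into UNIV \<phi> x, inv_into UNIV \<phi> y) \<in> parcs (graph M) \<longleftrightarrow> (x, y) \<in> parcs (graph M)"
      if "x \<in> pverts (graph M)" "y \<in> pverts (graph M)" for x y
    proof -
      have "(\<phi> (inv_into UNIV \<phi> x), \<phi> (inv_into UNIV \<phi> y)) \<in> parcs (graph M) \<longleftrightarrow>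
          (inv_into UNIV \<phi> x, inv_into UNIV \<phi> y) \<in> parcs (graph M)"
        using \<phi> m that unfolding map_automorphisms_def graph_automorphisms_def by blast
      then show ?thesis by (simp add: inv)
    qed
    have "inv_into UNIV \<phi> \<in> map_automorphisms M"
    proof (rule map_automorphismsI[OF pi arc])
      fix x y assume xy: "(x, y) \<in> parcs (graph M)"
      then have "(inv_into UNIV \<phi> x, inv_into UNIV \<phi> y) \<in> parcs (graph M)" using arc wf[OF xy] by blast
      then have "map_prod \<phi> \<phi> (rot M (inv_into UNIV \<phi> x, inv_into UNIV \<phi> y)) = rot M (x, y)"
        using \<phi> by (auto simp: map_automorphisms_def inv)
      then show "map_prod (inv_into UNIV \<phi>) (inv_into UNIV \<phi>) (rot M (x, y)) =
          rot M (inv_into UNIV \<phi> x, inv_into UNIV \<phi> y)"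
        by (metis (no_types, lifting) inv(2) map_prod_simp prod.collapse)
    qed
    moreover have "inv_into UNIV \<phi> \<circ> \<phi> = id" using inv by auto
    ultimately show "\<exists>\<psi>\<in>carrier (aut_group M). \<psi> \<otimes>\<^bsub>aut_group M\<^esub> \<phi> = \<one>\<^bsub>aut_group M\<^esub>" by auto
  qed (auto simp: comp comp_assoc map_prod.id intro!: map_automorphismsI permutes_id)
qed

section \<open>Left translations and the stabilizer of the identity\<close>

locale regular_cayley_map = group G for G (structure) +
  fixes X q
  assumes data: "cayley_map_data G X q" and regular: "regular_map (CM G X q)"
begin

abbreviation M where "M \<equiv> CM G X q"
abbreviation A where "A \<equiv> aut_group M"

lemma X_closed: "x \<in> X \<Longrightarrow> x \<in> carrier G" and one_notin_X: "\<one> \<notin> X"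
  and generate_X: "generate G X = carrier G" and q: "q permutes X" "cyclic_on q X"
  and finite_carrier: "finite (carrier G)"
  using data by (auto simp: cayley_map_data_def)

lemma q_closed: "x \<in> X \<Longrightarrow> q x \<in> X"
  using q by (simp add: permutes_in_image)

lemma graph_M: "graph M = Cay G X" "pverts (Cay G X) = carrier G"
  by (simp_all add: CM_def Cay_def)

lemma group_A: "group A"
  using group_aut_group[OF is_map_CM[OF data]] .

lemma arc_iff:
  "(g, h) \<in> parcs (Cay G X) \<longleftrightarrow> g \<in> carrier G \<and> h \<in> carrier G \<and> inv g \<otimes> h \<in> X"
  by (simp add: Cay_def)

lemma rot_M: "(g, h) \<in> parcs (Cay G X) \<Longrightarrow> rot M (g, h) = (g, g \<otimes> q (inv g \<otimes> h))"
  by (simp add: CM_def)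

lemma one_arc: "x \<in> X \<Longrightarrow> (\<one>, x) \<in> parcs (Cay G X)"
  using X_closed by (simp add: arc_iff)

lemma aut_permutes: "\<phi> \<in> map_automorphisms M \<Longrightarrow> \<phi> permutes carrier G"
  using graph_M by (simp add: map_automorphisms_def graph_automorphisms_def)

lemma finite_A: "finite (carrier A)"
  by (rule finite_subset[OF _ finite_permutations[OF finite_carrier]]) (use aut_permutes in auto)

lemma aut_arc:
  "\<phi> \<in> map_automorphisms M \<Longrightarrow> (x, y) \<in> parcs (Cay G X) \<Longrightarrow> (\<phi> x, \<phi> y) \<in> parcs (Cay G X)"
  using graph_M by (auto simp: map_automorphisms_def graph_automorphisms_def arc_iff)

text \<open>Regularity: only one automorphism carries the arc \<open>(\<one>, x)\<close> to its
  image.\<close>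

lemma aut_eqI:
  assumes "\<phi> \<in> map_automorphisms M" "\<psi> \<in> map_automorphisms M"
    and "x \<in> X" "\<phi> \<one> = \<psi> \<one>" "\<phi> x = \<psi> x"
  shows "\<phi> = \<psi>"
proof -
  have "(\<phi> \<one>, \<phi> x) \<in> parcs (Cay G X)" using aut_arc one_arc assms by blast
  then have "\<exists>!\<chi>. \<chi> \<in> map_automorphisms M \<and> map_prod \<chi> \<chi> (\<one>, x) = (\<phi> \<one>, \<phi> x)"
    using regular one_arc[OF assms(3)] graph_M unfolding regular_map_def by metis
  then show ?thesis using assms by auto
qed

text \<open>Left translation by \<open>g\<close>, extended by the identity outside the carrier
  because automorphisms must fix all non-vertices.\<close>

definition L where "L g = (\<lambda>x. if x \<in> carrier G then g \<otimes> x else x)"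

lemma L_aut:
  assumes g: "g \<in> carrier G"
  shows "L g \<in> map_automorphisms M"
proof (rule map_automorphismsI; (unfold graph_M)?)
  show "L g permutes carrier G"
    by (rule permutes_finite_inj[OF finite_carrier]) (use g in \<open>auto simp: L_def inj_on_def\<close>)
  have d: "inv (g \<otimes> x) \<otimes> (g \<otimes> y) = inv x \<otimes> y" if "x \<in> carrier G" "y \<in> carrier G" for x y
    using that g by (simp add: inv_mult_group m_assoc)
  show arc: "(L g x, L g y) \<in> parcs (Cay G X) \<longleftrightarrow> (x, y) \<in> parcs (Cay G X)"
    if "x \<in> carrier G" "y \<in> carrier G" for x y
    using that g d by (simp add: arc_iff L_def)
  fix x y assume xy: "(x, y) \<in> parcs (Cay G X)"
  then have c: "x \<in> carrier G" "y \<in> carrier G" "inv x \<otimes> y \<in> X" by (auto simp: arc_iff)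
  have "q (inv x \<otimes> y) \<in> carrier G" using X_closed q_closed c by blast
  then show "map_prod (L g) (L g) (rot M (x, y)) = rot M (L g x, L g y)"
    using c g d arc[OF c(1,2)] xy by (simp add: rot_M L_def m_assoc)
qed

lemma L_hom: "group_hom G A L"
proof -
  interpret A: group A by (rule group_A)
  show ?thesis
    by unfold_locales (auto simp: hom_def L_aut, auto simp: L_def fun_eq_iff m_assoc)
qed

lemma L_one: "g \<in> carrier G \<Longrightarrow> L g \<one> = g"
  by (simp add: L_def)

lemma L_inj: "g \<in> carrier G \<Longrightarrow> h \<in> carrier G \<Longrightarrow> L g = L h \<longleftrightarrow> g = h"
  by (metis L_one)

text \<open>At the vertex \<open>\<one>\<close> the rotation of the map is \<open>q\<close>
  itself.\<close>

lemma aut_q: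
  assumes "\<phi> \<in> map_automorphisms M" "\<phi> \<one> = \<one>" "x \<in> X"
  shows "\<phi> x \<in> X" and "\<phi> (q x) = q (\<phi> x)"
proof -
  have arc: "(\<one>, x) \<in> parcs (Cay G X)" using one_arc assms by blast
  have arc': "(\<one>, \<phi> x) \<in> parcs (Cay G X)" using aut_arc[OF assms(1) arc] assms(2) by simp
  then show x: "\<phi> x \<in> X" by (auto simp: arc_iff)
  have "map_prod \<phi> \<phi> (rot M (\<one>, x)) = rot M (\<phi> \<one>, \<phi> x)"
    using assms(1) arc graph_M by (auto simp: map_automorphisms_def)
  then show "\<phi> (q x) = q (\<phi> x)"
    using assms arc arc' x X_closed q_closed by (simp add: rot_M)
qed

lemma X_orbit: "x \<in> X \<Longrightarrow> y \<in> X \<Longrightarrow> \<exists>k. y = (q ^^ k) x"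
  using q(2) by (auto simp: cyclic_on_alldef orbit_altdef)

lemma q_pow_closed: "x \<in> X \<Longrightarrow> (q ^^ k) x \<in> X"
  by (induction k) (auto simp: q_closed)

text \<open>As \<open>q\<close> is a single cycle on \<open>X\<close>, the first return time of
  \<open>x\<close> is the size of \<open>X\<close>.\<close>

lemma q_pow_card: 
  assumes "x \<in> X"
  shows "(q ^^ card X) x = x"
proof -
  have X: "Orbits.orbit q x = X" using q(2) assms by (simp add: cyclic_on_alldef)
  then have x: "x \<in> Orbits.orbit q x" using assms by simp
  have "X = (\<lambda>n. (q ^^ n) x) ` {0..<funpow_dist1 q x x}"
    using orbit_conv_funpow_dist1[OF x] X by simp
  then have "card X = funpow_dist1 q x x"
    using card_image[OF inj_on_funpow_dist1[OF x]] by simp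
  then show ?thesis using funpow_dist1_prop[OF x] by simp
qed

text \<open>The automorphism group becomes an instance of \<open>dicyclic_factorization\<close>,
  with the translations as \<open>H\<close>, the rotation \<open>\<rho>\<close> as \<open>r\<close>,
  and the translations by \<open>z\<close> and \<open>b\<close> as \<open>t\<close> and
  \<open>b\<close>.\<close>

theorem no_central_involution:
  assumes prime: "prime (card X)" and z: "z \<in> X" "z \<otimes> z = \<one>"
    and central: "\<And>h. h \<in> carrier G \<Longrightarrow> h \<otimes> z = z \<otimes> h"
    and unique: "\<And>h. h \<in> carrier G \<Longrightarrow> h \<otimes> h = \<one> \<Longrightarrow> h = \<one> \<or> h = z"
    and conj: "\<And>d h. d \<in> carrier G \<Longrightarrow> h \<in> carrier G \<Longrightarrow> d \<otimes> d = z \<or> h \<otimes> d \<otimes> inv h \<in> {d, inv d}"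
    and b: "b \<in> carrier G" "b \<otimes> b = z"
  shows False
proof -
  interpret A: group A by (rule group_A)
  interpret L: group_hom G A L by (rule L_hom)
  have zc: "z \<in> carrier G" using z X_closed by blast
  \<comment> \<open>This yields \<open>\<rho>\<close>, the one-step rotation about
    \<open>\<one>\<close>.\<close>
  have "\<exists>!\<chi>. \<chi> \<in> map_automorphisms M \<and> map_prod \<chi> \<chi> (\<one>, z) = (\<one>, q z)"
    using regular one_arc[OF z(1)] one_arc[OF q_closed[OF z(1)]] graph_M unfolding regular_map_def by metis
  then obtain \<rho> where \<rho>: "\<rho> \<in> map_automorphisms M" "\<rho> \<one> = \<one>" "\<rho> z = q z" by auto
  have \<rho>_q: "\<rho> ((q ^^ k) z) = q ((q ^^ k) z)" for k
    by (induction k) (auto simp: \<rho> z aut_q(2)[OF \<rho>(1,2)] q_pow_closed q_closed)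
  have pow_z: "(\<rho> ^^ k) z = (q ^^ k) z" for k
    by (induction k) (auto simp: \<rho>_q)
  have pow_one: "(\<rho> ^^ k) \<one> = \<one>" for k
    by (induction k) (auto simp: \<rho>)
  have pow_aut: "\<rho> ^^ k \<in> map_automorphisms M" for k
    using A.nat_pow_closed[of \<rho> k] \<rho> by (simp add: aut_group_pow)
  \<comment> \<open>An automorphism fixing \<open>\<one>\<close> is determined by the image of
    \<open>z\<close>, and the powers of \<open>\<rho>\<close> reach every point of the cycle
    \<open>X\<close>.\<close>
  have stab: "\<exists>k. \<phi> = \<rho> ^^ k" if \<phi>: "\<phi> \<in> map_automorphisms M" "\<phi> \<one> = \<one>" for \<phi>
  proof -
    obtain k where "\<phi> z = (q ^^ k) z" using X_orbit[OF z(1) aut_q(1)[OF \<phi> z(1)]] by blast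
    then have "\<phi> = \<rho> ^^ k" using aut_eqI[OF \<phi>(1) pow_aut z(1)] pow_one pow_z \<phi> by simp
    then show ?thesis by blast
  qed
  \<comment> \<open>Translating \<open>\<phi> \<one>\<close> back to \<open>\<one>\<close> leaves an
    element of the stabilizer.\<close>
  have fact: "\<exists>k. \<phi> = L (\<phi> \<one>) \<circ> \<rho> ^^ k" if \<phi>: "\<phi> \<in> map_automorphisms M" for \<phi>
  proof -
    have g: "\<phi> \<one> \<in> carrier G" using permutes_in_image[OF aut_permutes[OF \<phi>]] by simp
    have "L (inv (\<phi> \<one>)) \<circ> \<phi> \<in> map_automorphisms M"
      using A.m_closed[of "L (inv (\<phi> \<one>))" \<phi>] L_aut g \<phi> by (simp del: L.hom_inv)
    moreover have "(L (inv (\<phi> \<one>)) \<circ> \<phi>) \<one> = \<one>" using g by (simp add: L_def)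
    ultimately obtain k where k: "L (inv (\<phi> \<one>)) \<circ> \<phi> = \<rho> ^^ k" using stab by blast
    have "L (\<phi> \<one>) \<otimes>\<^bsub>A\<^esub> (L (inv (\<phi> \<one>)) \<otimes>\<^bsub>A\<^esub> \<phi>) = \<phi>"
      using g \<phi> L.hom_inv[OF g] A.m_assoc[of "L (\<phi> \<one>)" "L (inv (\<phi> \<one>))" \<phi>] L_aut
      by (metis A.l_one A.r_inv L.hom_closed aut_group_simps(1) inv_closed)
    then show ?thesis using k by (intro exI[of _ k]) simp
  qed
  \<comment> \<open>For \<open>x = q^k z\<close>, conjugating \<open>L z\<close> by
    \<open>\<rho>^k\<close> gives an automorphism taking \<open>\<one>\<close> to \<open>x\<close>;
    it differs from \<open>L x\<close> by a power of \<open>\<rho>\<close>. So every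
    \<open>L x\<close> is generated, hence every translation.\<close>
  have gen: "generate A {\<rho>, L z} = carrier A"
  proof
    show "generate A {\<rho>, L z} \<subseteq> carrier A"
      by (rule A.generate_incl) (use \<rho> L_aut zc in auto)
    have S: "subgroup (generate A {\<rho>, L z}) A"
      by (rule A.generate_is_subgroup) (use \<rho> L_aut zc in auto)
    have pS: "\<rho> ^^ k \<in> generate A {\<rho>, L z}" for k
    proof (induction k)
      case 0
      show ?case using subgroup.one_closed[OF S] by (simp add: id_def)
    next
      case (Suc k)
      show ?case using subgroup.m_closed[OF S generate.incl[of \<rho> "{\<rho>, L z}" A] Suc] by (simp add: comp_def)
    qed
    have LX: "L x \<in> generate A {\<rho>, L z}" if x: "x \<in> X" for x
    proof -
      obtain k where k: "x = (q ^^ k) z" using X_orbit[OF z(1) x] by blast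
      define \<psi> where "\<psi> = inv\<^bsub>A\<^esub> (\<rho> ^^ k)"
      have \<psi>: "\<psi> \<in> map_automorphisms M" "\<psi> \<circ> \<rho> ^^ k = id"
        using A.inv_closed[of "\<rho> ^^ k"] A.l_inv[of "\<rho> ^^ k"] pow_aut by (simp_all add: \<psi>_def)
      have "\<psi> \<one> = \<one>" using fun_cong[OF \<psi>(2), of \<one>] pow_one by simp
      define \<phi> where "\<phi> = \<rho> ^^ k \<circ> L z \<circ> \<psi>"
      have "\<phi> \<one> = x" using \<open>\<psi> \<one> = \<one>\<close> k zc by (simp add: \<phi>_def L_one pow_z)
      have \<phi>S: "\<phi> \<in> generate A {\<rho>, L z}"
        using subgroup.m_closed[OF S subgroup.m_closed[OF S pS[of k] generate.incl[of "L z" "{\<rho>, L z}" A]]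
            subgroup.m_inv_closed[OF S pS[of k]]]
        by (simp add: \<phi>_def \<psi>_def)
      then have \<phi>: "\<phi> \<in> map_automorphisms M" using subgroup.mem_carrier[OF S] by simp
      then obtain j where "\<phi> = L x \<otimes>\<^bsub>A\<^esub> \<rho> ^^ j" using fact \<open>\<phi> \<one> = x\<close> by auto
      then have "L x = \<phi> \<otimes>\<^bsub>A\<^esub> inv\<^bsub>A\<^esub> (\<rho> ^^ j)"
        using A.inv_solve_right[of "L x" \<phi> "\<rho> ^^ j"] L_aut X_closed[OF x] pow_aut \<phi> by simp
      then show ?thesis
        using subgroup.m_closed[OF S \<phi>S subgroup.m_inv_closed[OF S pS[of j]]] by simp
    qed
    have LS: "L g \<in> generate A {\<rho>, L z}" if "g \<in> generate G X" for g
      using that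
    proof induction
      case one
      then show ?case unfolding L.hom_one by (rule subgroup.one_closed[OF S])
    next
      case (incl h)
      then show ?case by (rule LX)
    next
      case (inv h)
      then show ?case using LX subgroup.m_inv_closed[OF S] L.hom_inv X_closed by simp
    next
      case (eng g h)
      then show ?case using subgroup.m_closed[OF S] L.hom_mult generate_X by metis
    qed
    show "carrier A \<subseteq> generate A {\<rho>, L z}"
    proof
      fix \<phi> assume "\<phi> \<in> carrier A"
      then have \<phi>: "\<phi> \<in> map_automorphisms M" by simp
      then obtain k where "\<phi> = L (\<phi> \<one>) \<otimes>\<^bsub>A\<^esub> \<rho> ^^ k" using fact by auto
      moreover have "\<phi> \<one> \<in> generate G X"
        using permutes_in_image[OF aut_permutes[OF \<phi>]] generate_X by simp
      ultimately show "\<phi> \<in> generate A {\<rho>, L z}"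
        using subgroup.m_closed[OF S LS pS] by metis
    qed
  qed
  interpret dicyclic_factorization A "L ` carrier G" \<rho> "L z" "L b" "card X"
  proof (intro dicyclic_factorization.intro dicyclic_factorization_axioms.intro group_A)
    show "finite (carrier A)" by (rule finite_A)
    show "prime (card X)" by (rule prime)
    show "subgroup (L ` carrier G) A" by (rule L.img_is_subgroup)
    show "\<rho> \<in> carrier A" using \<rho> by simp
    have "\<rho> ^^ card X = id"
      using aut_eqI[OF pow_aut A.one_closed[simplified] z(1)] pow_one pow_z q_pow_card[OF z(1)] by simp
    then show "\<rho> [^]\<^bsub>A\<^esub> card X = \<one>\<^bsub>A\<^esub>" by (simp add: aut_group_pow)
    show "L z \<in> L ` carrier G" "L b \<in> L ` carrier G" using zc b by auto
    have hom: "L g \<otimes>\<^bsub>A\<^esub> L h = L (g \<otimes> h)" if "g \<in> carrier G" "h \<in> carrier G" for g h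
      by (simp only: L.hom_mult[OF that])
    note one = L.hom_one[symmetric]
    show "L z \<noteq> \<one>\<^bsub>A\<^esub>" using L_one[OF zc] z one_notin_X by auto
    show "L z \<otimes>\<^bsub>A\<^esub> L z = \<one>\<^bsub>A\<^esub>" "L b \<otimes>\<^bsub>A\<^esub> L b = L z"
      unfolding one hom[OF zc zc] hom[OF b(1) b(1)] using z b by simp_all
    show "generate A {\<rho>, L z} = carrier A" by (rule gen)
    show "\<exists>h\<in>L ` carrier G. \<exists>i::nat. \<phi> = h \<otimes>\<^bsub>A\<^esub> \<rho> [^]\<^bsub>A\<^esub> i" if "\<phi> \<in> carrier A" for \<phi>
      using fact[of \<phi>] permutes_in_image[OF aut_permutes, of \<phi> \<one>] that by (auto simp: aut_group_pow)
    show "\<rho> [^]\<^bsub>A\<^esub> i = \<one>\<^bsub>A\<^esub>" if *: "\<rho> [^]\<^bsub>A\<^esub> i \<in> L ` carrier G" for i :: nat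
    proof -
      obtain g where g: "g \<in> carrier G" "\<rho> ^^ i = L g" using * by (auto simp: aut_group_pow)
      then have "g = \<one>" using L_one pow_one[of i] by metis
      then show ?thesis unfolding one using g by (simp only: aut_group_pow)
    qed
    show "h \<otimes>\<^bsub>A\<^esub> L z = L z \<otimes>\<^bsub>A\<^esub> h" if "h \<in> L ` carrier G" for h
    proof -
      obtain g where g: "g \<in> carrier G" "h = L g" using \<open>h \<in> L ` carrier G\<close> by auto
      show ?thesis unfolding g hom[OF g(1) zc] hom[OF zc g(1)] central[OF g(1)] ..
    qed
    show "h = \<one>\<^bsub>A\<^esub> \<or> h = L z" if *: "h \<in> L ` carrier G" "h \<otimes>\<^bsub>A\<^esub> h = \<one>\<^bsub>A\<^esub>" for h
    proof -
      obtain g where g: "g \<in> carrier G" "h = L g" using *(1) by auto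
      then have "L (g \<otimes> g) = L \<one>" using *(2) unfolding one g(2) hom[OF g(1) g(1)] by simp
      then have "g \<otimes> g = \<one>" using L_inj[of "g \<otimes> g" \<one>] g by simp
      then show ?thesis using unique[OF g(1)] unfolding one g(2) by blast
    qed
    show "d \<otimes>\<^bsub>A\<^esub> d = L z \<or> h \<otimes>\<^bsub>A\<^esub> d \<otimes>\<^bsub>A\<^esub> inv\<^bsub>A\<^esub> h \<in> {d, inv\<^bsub>A\<^esub> d}"
      if *: "d \<in> L ` carrier G" "h \<in> L ` carrier G" for d h
    proof -
      obtain e k where e: "e \<in> carrier G" "d = L e" "k \<in> carrier G" "h = L k" using * by auto
      have eqs: "d \<otimes>\<^bsub>A\<^esub> d = L (e \<otimes> e)" "h \<otimes>\<^bsub>A\<^esub> d \<otimes>\<^bsub>A\<^esub> inv\<^bsub>A\<^esub> h = L (k \<otimes> e \<otimes> inv k)"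
        "inv\<^bsub>A\<^esub> d = L (inv e)"
        unfolding e using e hom by (simp_all del: aut_group_simps L.hom_mult L.hom_inv flip: L.hom_inv)
      show ?thesis unfolding eqs using conj[OF e(1,3)] e(2) by (simp only: insert_iff empty_iff) metis
    qed
  qed
  show False by (rule contradiction)
qed

end

section \<open>Dicyclic groups\<close>

text \<open>The orbits \<open>{x, f x}\<close> of the fixed-point-free involution \<open>f\<close>
  partition \<open>X\<close> into pairs.\<close>

lemma even_card_if_no_fixpoint:
  assumes "finite X" "\<And>x. x \<in> X \<Longrightarrow> f x \<in> X \<and> f (f x) = x \<and> f x \<noteq> x"
  shows "even (card X)"
proof -
  have "\<Union> ((\<lambda>x. {x, f x}) ` X) = X" using assms(2) by auto
  moreover have "2 dvd card (\<Union> ((\<lambda>x. {x, f x}) ` X))"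
  proof (rule dvd_partition)
    show "\<forall>c1\<in>(\<lambda>x. {x, f x}) ` X. \<forall>c2\<in>(\<lambda>x. {x, f x}) ` X. c1 \<noteq> c2 \<longrightarrow> c1 \<inter> c2 = {}"
    proof (intro ballI impI, elim imageE, intro equals0I)
      fix c1 c2 x y w assume *: "c1 \<noteq> c2" "c1 = {x, f x}" "c2 = {y, f y}" "x \<in> X" "y \<in> X" "w \<in> c1 \<inter> c2"
      have "x = y \<or> x = f y" using * assms(2)[of x] assms(2)[of y] by auto
      then show False using * assms(2)[of y] by auto
    qed
    have "card {x, f x} = 2" if "x \<in> X" for x using assms(2)[OF that] by auto
    then show "\<forall>c\<in>(\<lambda>x. {x, f x}) ` X. 2 dvd card c" by auto
  qed (use assms(1) in auto)
  ultimately show ?thesis by simp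
qed

section \<open>Normal forms in the dicyclic group\<close>

locale dicyclic =
  fixes n :: nat
  assumes n: "n > 0"
begin

sublocale group "Dic n" by (rule group_Dic)

abbreviation D where "D \<equiv> Dic n"
definition a where "a = word_class (dic_relations n) [(DA, True)]"
definition b where "b = word_class (dic_relations n) [(DB, True)]"

lemma ab_closed: "a \<in> carrier D" "b \<in> carrier D"
  by (auto simp: a_def b_def carrier_Dic)

lemma a_pow: "a [^]\<^bsub>D\<^esub> k = word_class (dic_relations n) (replicate k (DA, True))"
  by (induction k) (simp_all add: Dic_one Dic_mult a_def replicate_append_same[symmetric])

lemma nf: "word_class (dic_relations n) (dic_nf k e) = (if e then a [^]\<^bsub>D\<^esub> k \<otimes>\<^bsub>D\<^esub> b else a [^]\<^bsub>D\<^esub> k)"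
  by (simp add: dic_nf_def a_pow b_def Dic_mult)

text \<open>Surjectivity of \<open>bij_betw_nf\<close>, phrased as a case rule.\<close>

lemma elem_cases:
  assumes "x \<in> carrier D"
  obtains k where "k < 2 * n" "x = a [^]\<^bsub>D\<^esub> k" | k where "k < 2 * n" "x = a [^]\<^bsub>D\<^esub> k \<otimes>\<^bsub>D\<^esub> b"
proof -
  have "x \<in> (\<lambda>(k, e). word_class (dic_relations n) (dic_nf k e)) ` ({..<2 * n} \<times> UNIV)"
    unfolding bij_betw_imp_surj_on[OF bij_betw_nf[OF n]] by (rule assms)
  then obtain y where y: "x = (case y of (k, e) \<Rightarrow> word_class (dic_relations n) (dic_nf k e))"
    "y \<in> {..<2 * n} \<times> UNIV" by (rule imageE)
  show ?thesis
  proof (cases y)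
    case (Pair k e)
    then have "k < 2 * n" "x = (if e then a [^]\<^bsub>D\<^esub> k \<otimes>\<^bsub>D\<^esub> b else a [^]\<^bsub>D\<^esub> k)"
      using y by (simp_all only: nf case_prod_conv mem_Sigma_iff lessThan_iff)
    then show ?thesis using that by (metis (full_types))
  qed
qed

lemma a_pow_2n: "a [^]\<^bsub>D\<^esub> (2 * n) = \<one>\<^bsub>D\<^esub>"
  unfolding a_pow Dic_one word_class_eq_iff by (rule word_eq.relation) (simp add: dic_relations_def)

lemma bb: "b \<otimes>\<^bsub>D\<^esub> b = a [^]\<^bsub>D\<^esub> n"
  unfolding a_pow b_def Dic_mult word_class_eq_iff by (rule word_eq.relation) (simp add: dic_relations_def)

lemma inv_gen: "inv\<^bsub>D\<^esub> (word_class (dic_relations n) [(x, True)]) = word_class (dic_relations n) [(x, False)]"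
  using word_eq.cancel[of "dic_relations n" x False]
  by (intro inv_equality) (auto simp: Dic_mult Dic_one word_class_eq_iff carrier_Dic)

lemma conj_b_a: "inv\<^bsub>D\<^esub> b \<otimes>\<^bsub>D\<^esub> a \<otimes>\<^bsub>D\<^esub> b = inv\<^bsub>D\<^esub> a"
  unfolding a_def b_def inv_gen Dic_mult word_class_eq_iff
  by (rule word_eq.relation) (simp add: dic_relations_def)

lemma a_b: "a \<otimes>\<^bsub>D\<^esub> b = b \<otimes>\<^bsub>D\<^esub> inv\<^bsub>D\<^esub> a"
proof -
  have "a \<otimes>\<^bsub>D\<^esub> b = b \<otimes>\<^bsub>D\<^esub> (inv\<^bsub>D\<^esub> b \<otimes>\<^bsub>D\<^esub> a \<otimes>\<^bsub>D\<^esub> b)" using ab_closed by (simp add: m_assoc)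
  then show ?thesis by (simp only: conj_b_a)
qed

lemma b_a: "b \<otimes>\<^bsub>D\<^esub> a = inv\<^bsub>D\<^esub> a \<otimes>\<^bsub>D\<^esub> b"
proof -
  have "b \<otimes>\<^bsub>D\<^esub> a = inv\<^bsub>D\<^esub> a \<otimes>\<^bsub>D\<^esub> (a \<otimes>\<^bsub>D\<^esub> b) \<otimes>\<^bsub>D\<^esub> a"
    using ab_closed by (simp add: m_assoc)
  also have "\<dots> = inv\<^bsub>D\<^esub> a \<otimes>\<^bsub>D\<^esub> b"
    unfolding a_b using ab_closed by (simp add: m_assoc)
  finally show ?thesis .
qed

lemma b_a_pow: "b \<otimes>\<^bsub>D\<^esub> a [^]\<^bsub>D\<^esub> (k::nat) = inv\<^bsub>D\<^esub> (a [^]\<^bsub>D\<^esub> k) \<otimes>\<^bsub>D\<^esub> b"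
proof (induction k)
  case (Suc k)
  have "b \<otimes>\<^bsub>D\<^esub> a [^]\<^bsub>D\<^esub> Suc k = b \<otimes>\<^bsub>D\<^esub> a [^]\<^bsub>D\<^esub> k \<otimes>\<^bsub>D\<^esub> a" using ab_closed by (simp add: m_assoc)
  also have "\<dots> = inv\<^bsub>D\<^esub> (a [^]\<^bsub>D\<^esub> k) \<otimes>\<^bsub>D\<^esub> (b \<otimes>\<^bsub>D\<^esub> a)" unfolding Suc using ab_closed by (simp add: m_assoc)
  also have "\<dots> = inv\<^bsub>D\<^esub> (a \<otimes>\<^bsub>D\<^esub> a [^]\<^bsub>D\<^esub> k) \<otimes>\<^bsub>D\<^esub> b"
    unfolding b_a using ab_closed by (simp add: inv_mult_group m_assoc)
  also have "a \<otimes>\<^bsub>D\<^esub> a [^]\<^bsub>D\<^esub> k = a [^]\<^bsub>D\<^esub> Suc k" using nat_pow_Suc2[OF ab_closed(1)] by simp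
  finally show ?case .
qed (use ab_closed in simp)

text \<open>Distinct normal forms are distinct elements, so \<open>a\<close> has order exactly
  \<open>2 * n\<close>.\<close>

lemma a_pow_eq_one:
  assumes "k < 2 * n" "a [^]\<^bsub>D\<^esub> k = \<one>\<^bsub>D\<^esub>"
  shows "k = 0"
proof -
  have "word_class (dic_relations n) (dic_nf k False) = word_class (dic_relations n) (dic_nf 0 False)"
    using assms by (simp add: nf)
  then show ?thesis using inj_onD[OF bij_betw_imp_inj_on[OF bij_betw_nf[OF n]], of "(k, False)" "(0, False)"] assms n
    by simp
qed

section \<open>The central involution\<close>

definition z where "z = a [^]\<^bsub>D\<^esub> n"

lemma z_closed: "z \<in> carrier D"
  using ab_closed by (simp add: z_def)

lemma zz: "z \<otimes>\<^bsub>D\<^esub> z = \<one>\<^bsub>D\<^esub>"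
  using ab_closed a_pow_2n by (simp add: z_def nat_pow_mult mult_2)

lemma inv_z: "inv\<^bsub>D\<^esub> z = z"
  using zz z_closed by (simp add: inv_equality)

text \<open>Moving \<open>b\<close> past \<open>a^k\<close> inverts the power, so the two powers
  cancel and \<open>b b\<close> remains.\<close>

lemma square_reflection:
  "a [^]\<^bsub>D\<^esub> (k::nat) \<otimes>\<^bsub>D\<^esub> b \<otimes>\<^bsub>D\<^esub> (a [^]\<^bsub>D\<^esub> k \<otimes>\<^bsub>D\<^esub> b) = z"
proof -
  have "a [^]\<^bsub>D\<^esub> k \<otimes>\<^bsub>D\<^esub> b \<otimes>\<^bsub>D\<^esub> (a [^]\<^bsub>D\<^esub> k \<otimes>\<^bsub>D\<^esub> b) = a [^]\<^bsub>D\<^esub> k \<otimes>\<^bsub>D\<^esub> (b \<otimes>\<^bsub>D\<^esub> a [^]\<^bsub>D\<^esub> k) \<otimes>\<^bsub>D\<^esub> b"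
    using ab_closed by (simp add: m_assoc)
  also have "\<dots> = b \<otimes>\<^bsub>D\<^esub> b" unfolding b_a_pow using ab_closed by (simp flip: m_assoc)
  finally show ?thesis by (simp add: bb z_def)
qed

lemma a_pow_commute: "a [^]\<^bsub>D\<^esub> (k::nat) \<otimes>\<^bsub>D\<^esub> a [^]\<^bsub>D\<^esub> (l::nat) = a [^]\<^bsub>D\<^esub> l \<otimes>\<^bsub>D\<^esub> a [^]\<^bsub>D\<^esub> k"
  using ab_closed by (simp add: nat_pow_mult add.commute)

lemma central_z:
  assumes "h \<in> carrier D"
  shows "h \<otimes>\<^bsub>D\<^esub> z = z \<otimes>\<^bsub>D\<^esub> h"
  using assms
proof (cases rule: elem_cases)
  case (1 k)
  then show ?thesis by (simp add: z_def a_pow_commute)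
next
  case (2 k)
  have "b \<otimes>\<^bsub>D\<^esub> z = z \<otimes>\<^bsub>D\<^esub> b" using b_a_pow[of n] inv_z by (simp add: z_def)
  then have "h \<otimes>\<^bsub>D\<^esub> z = a [^]\<^bsub>D\<^esub> k \<otimes>\<^bsub>D\<^esub> z \<otimes>\<^bsub>D\<^esub> b"
    using 2 ab_closed z_closed by (simp add: m_assoc)
  also have "\<dots> = z \<otimes>\<^bsub>D\<^esub> h"
    unfolding 2 z_def a_pow_commute[of k n] using ab_closed by (simp add: m_assoc)
  finally show ?thesis .
qed

lemma z_neq_one: "z \<noteq> \<one>\<^bsub>D\<^esub>"
  using a_pow_eq_one[of n] n by (auto simp: z_def)

text \<open>Elements \<open>a^k b\<close> square to \<open>z\<close>, which is not one; for
  \<open>a^k\<close> the order \<open>2 * n\<close> leaves \<open>k = 0\<close> and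
  \<open>k = n\<close>.\<close>

lemma unique_involution:
  assumes "h \<in> carrier D" "h \<otimes>\<^bsub>D\<^esub> h = \<one>\<^bsub>D\<^esub>"
  shows "h = \<one>\<^bsub>D\<^esub> \<or> h = z"
  using assms(1)
proof (cases rule: elem_cases)
  case (1 k)
  then have k: "a [^]\<^bsub>D\<^esub> (2 * k) = \<one>\<^bsub>D\<^esub>" using assms ab_closed by (simp add: nat_pow_mult mult_2)
  show ?thesis
  proof (cases "k < n")
    case True
    then show ?thesis using a_pow_eq_one[OF _ k] 1 by simp
  next
    case False
    \<comment> \<open>Removing one full period brings the exponent below \<open>2 * n\<close>, where
      \<open>a_pow_eq_one\<close> applies.\<close>
    then have "2 * n + 2 * (k - n) = 2 * k" by linarith
    then have "a [^]\<^bsub>D\<^esub> (2 * n) \<otimes>\<^bsub>D\<^esub> a [^]\<^bsub>D\<^esub> (2 * (k - n)) = a [^]\<^bsub>D\<^esub> (2 * k)"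
      using ab_closed(1) by (simp only: nat_pow_mult)
    then have "a [^]\<^bsub>D\<^esub> (2 * (k - n)) = \<one>\<^bsub>D\<^esub>" using k a_pow_2n ab_closed by simp
    moreover have "2 * (k - n) < 2 * n" using 1(1) False by linarith
    ultimately have "2 * (k - n) = 0" using a_pow_eq_one by blast
    then show ?thesis using False 1 by (simp add: z_def)
  qed
next
  case (2 k)
  then show ?thesis using assms square_reflection z_neq_one by simp
qed

text \<open>Elements \<open>a^k b\<close> have square \<open>z\<close>; a power of \<open>a\<close>
  is centralized by the powers of \<open>a\<close> and inverted by the elements
  \<open>a^l b\<close>.\<close>

lemma conj_cases:
  assumes "d \<in> carrier D" "h \<in> carrier D"
  shows "d \<otimes>\<^bsub>D\<^esub> d = z \<or> h \<otimes>\<^bsub>D\<^esub> d \<otimes>\<^bsub>D\<^esub> inv\<^bsub>D\<^esub> h \<in> {d, inv\<^bsub>D\<^esub> d}"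
  using assms(1)
proof (cases rule: elem_cases)
  case d: (1 k)
  show ?thesis using assms(2)
  proof (cases rule: elem_cases)
    case (1 l)
    have "h \<otimes>\<^bsub>D\<^esub> d = d \<otimes>\<^bsub>D\<^esub> h" unfolding 1(2) d(2) by (rule a_pow_commute)
    then have "h \<otimes>\<^bsub>D\<^esub> d \<otimes>\<^bsub>D\<^esub> inv\<^bsub>D\<^esub> h = d \<otimes>\<^bsub>D\<^esub> h \<otimes>\<^bsub>D\<^esub> inv\<^bsub>D\<^esub> h" by simp
    also have "\<dots> = d" using assms by (simp add: m_assoc)
    finally show ?thesis by simp
  next
    case (2 l)
    \<comment> \<open>Writing the inverse of \<open>d\<close> with a natural exponent lets
      \<open>a_pow_commute\<close> apply to it.\<close>
    have "a [^]\<^bsub>D\<^esub> (2 * n - k) \<otimes>\<^bsub>D\<^esub> d = a [^]\<^bsub>D\<^esub> (2 * n)"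
      unfolding d(2) using d(1) ab_closed(1) by (simp add: nat_pow_mult)
    then have inv_d: "inv\<^bsub>D\<^esub> d = a [^]\<^bsub>D\<^esub> (2 * n - k)"
      using a_pow_2n assms(1) ab_closed by (intro inv_equality) simp_all
    have "h \<otimes>\<^bsub>D\<^esub> d = a [^]\<^bsub>D\<^esub> l \<otimes>\<^bsub>D\<^esub> (b \<otimes>\<^bsub>D\<^esub> a [^]\<^bsub>D\<^esub> k)"
      unfolding 2(2) d(2) using ab_closed by (simp add: m_assoc)
    also have "\<dots> = a [^]\<^bsub>D\<^esub> l \<otimes>\<^bsub>D\<^esub> inv\<^bsub>D\<^esub> d \<otimes>\<^bsub>D\<^esub> b"
      unfolding b_a_pow d(2) using ab_closed by (simp add: m_assoc)
    also have "\<dots> = inv\<^bsub>D\<^esub> d \<otimes>\<^bsub>D\<^esub> h"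
      unfolding inv_d a_pow_commute[of l "2 * n - k"] 2(2) using ab_closed by (simp add: m_assoc)
    finally have "h \<otimes>\<^bsub>D\<^esub> d = inv\<^bsub>D\<^esub> d \<otimes>\<^bsub>D\<^esub> h" .
    then have "h \<otimes>\<^bsub>D\<^esub> d \<otimes>\<^bsub>D\<^esub> inv\<^bsub>D\<^esub> h = inv\<^bsub>D\<^esub> d \<otimes>\<^bsub>D\<^esub> h \<otimes>\<^bsub>D\<^esub> inv\<^bsub>D\<^esub> h" by simp
    also have "\<dots> = inv\<^bsub>D\<^esub> d" using assms by (simp add: m_assoc)
    finally show ?thesis by simp
  qed
next
  case (2 k)
  then show ?thesis using square_reflection by simp
qed

text \<open>Since \<open>b\<close> inverts \<open>a\<close>, commuting forces
  \<open>a^2 = 1\<close>, while \<open>a\<close> has order \<open>2 * n\<close>.\<close>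

lemma abelian_imp_n_eq_1:
  assumes "a \<otimes>\<^bsub>D\<^esub> b = b \<otimes>\<^bsub>D\<^esub> a"
  shows "n = 1"
proof (rule ccontr)
  assume "n \<noteq> 1"
  have "a \<otimes>\<^bsub>D\<^esub> b = inv\<^bsub>D\<^esub> a \<otimes>\<^bsub>D\<^esub> b" using assms b_a by simp
  then have "a = inv\<^bsub>D\<^esub> a" using ab_closed by (metis inv_closed right_cancel)
  then have "a \<otimes>\<^bsub>D\<^esub> a = \<one>\<^bsub>D\<^esub>" using r_inv[OF ab_closed(1)] by metis
  then have "a [^]\<^bsub>D\<^esub> (2::nat) = \<one>\<^bsub>D\<^esub>" using ab_closed by (simp add: numeral_2_eq_2)
  then show False using a_pow_eq_one[of 2] n \<open>n \<noteq> 1\<close> by simp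
qed

end

text \<open>The group generated by \<open>x\<close> and its inverse is the cyclic group of
  \<open>x\<close>.\<close>

lemma (in group) generate_inverse_pair_commute:
  assumes x: "x \<in> carrier G" and g: "g \<in> generate G {x, inv x}" and h: "h \<in> generate G {x, inv x}"
  shows "g \<otimes> h = h \<otimes> g"
proof -
  have sub: "generate G {x, inv x} \<subseteq> generate G {x}"
    by (rule generate_subgroup_incl[OF _ generate_is_subgroup])
      (use x in \<open>auto intro: generate.incl generate.inv\<close>)
  then obtain i j :: int where "g = x [^] i" "h = x [^] j"
    using subsetD[OF sub g] subsetD[OF sub h] unfolding generate_pow[OF x] by blast
  then show ?thesis using x by (simp add: add.commute flip: int_pow_mult)
qed

text \<open>The pair \<open>p = 2\<close>, \<open>n = 1\<close> is a genuine exception: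
  \<open>regular_2_valent_Dic_1\<close> provides a regular 2-valent Cayley map on
  \<open>Dic 1\<close>.\<close>

theorem theorem1p3:
  fixes p n :: nat
  assumes "prime p" and "n > 0" and "\<not> (p = 2 \<and> n = 1)"
  shows "\<not> (\<exists>X q. cayley_map_data (Dic n) X q \<and> card X = p \<and> regular_map (CM (Dic n) X q))"
proof
  assume "\<exists>X q. cayley_map_data (Dic n) X q \<and> card X = p \<and> regular_map (CM (Dic n) X q)"
  then obtain X q where data: "cayley_map_data (Dic n) X q" and card: "card X = p"
    and reg: "regular_map (CM (Dic n) X q)" by blast
  interpret D: dicyclic n by unfold_locales (rule assms(2))
  interpret C: regular_cayley_map "Dic n" X q by unfold_locales (use data reg in auto)
  have inv_X: "inv\<^bsub>Dic n\<^esub> x \<in> X" if "x \<in> X" for x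
    using data that by (auto simp: cayley_map_data_def)
  show False
  proof (cases "\<exists>x\<in>X. inv\<^bsub>Dic n\<^esub> x = x")
    case True
    then obtain x where x: "x \<in> X" "inv\<^bsub>Dic n\<^esub> x = x" by blast
    then have "x \<otimes>\<^bsub>Dic n\<^esub> x = \<one>\<^bsub>Dic n\<^esub>" using D.r_inv[OF C.X_closed[OF x(1)]] by simp
    then have "x = D.z" using D.unique_involution[OF C.X_closed[OF x(1)]] x(1) C.one_notin_X by blast
    then have "D.z \<in> X" using x by simp
    moreover have "prime (card X)" using assms(1) card by simp
    moreover have "D.b \<otimes>\<^bsub>Dic n\<^esub> D.b = D.z" by (simp only: D.bb D.z_def)
    ultimately show False
      using C.no_central_involution[OF _ _ D.zz D.central_z D.unique_involution D.conj_cases D.ab_closed(2)]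
      by blast
  next
    case False
    have finX: "finite X" using finite_subset[OF _ C.finite_carrier] C.X_closed by blast
    have "even (card X)"
      by (rule even_card_if_no_fixpoint[OF finX, of "\<lambda>x. inv\<^bsub>Dic n\<^esub> x"]) (use False inv_X C.X_closed in auto)
    then have p: "p = 2" using primes_dvd_imp_eq[of 2 p] assms(1) card by simp
    \<comment> \<open>With two elements and no fixed point of inversion, \<open>X\<close> is
      \<open>{x, inv x}\<close>; it generates an abelian group, which leaves only the excluded
      case.\<close>
    obtain x where x: "x \<in> X" using card p by fastforce
    then have "inv\<^bsub>Dic n\<^esub> x \<noteq> x" using False by blast
    then have "card {x, inv\<^bsub>Dic n\<^esub> x} = 2" by (metis card_2_iff)
    moreover have "{x, inv\<^bsub>Dic n\<^esub> x} \<subseteq> X" using x inv_X by simp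
    ultimately have "X = {x, inv\<^bsub>Dic n\<^esub> x}" using card_subset_eq[OF finX] card p by metis
    then have "D.a \<otimes>\<^bsub>Dic n\<^esub> D.b = D.b \<otimes>\<^bsub>Dic n\<^esub> D.a"
      using D.generate_inverse_pair_commute[of x] C.X_closed[OF x] C.generate_X D.ab_closed by simp
    then show False using D.abelian_imp_n_eq_1 p assms(3) by blast
  qed
qed

end
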